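(* For any integer $k\geq 2$, $$\frac{1}{\sqrt{2(k-1)}}\geq f_{k}>\frac{1}{\sqrt{2(k-1)}+\sqrt{2}}=\frac{1}{\sqrt{2(k-1)}}+O\left(k^{-1}\right),$$ and $$\frac{1}{\sqrt{2(k-1)}}\geq f_{-k+1}>\frac{1}{\sqrt{2(k-1)}+\sqrt{2}}=\frac{1}{\sqrt{2(k-1)}}+O\left(k^{-1}\right),$$ where the $O$-terms are as $k\to\infty$.
   Context: Graphs are finite, simple and undirected; $v(G)$ is the order (number of vertices) of $G$, and $\overline{G}$ is the complement of $G$. For a graph $G$ of order $n$, $\lambda_1(G)\ge\cdots\ge\lambda_n(G)$ denote the eigenvalues of its adjacency matrix, with multiplicity. For $n\ge j\ge1$ let $$f_{j}(n)=\max_{v(G)=n}\big(\lambda_{j}(G)+\lambda_{j}(\overline{G})\big),\qquad f_{-j}(n)=\max_{v(G)=n}\big(|\lambda_{n-j+1}(G)|+|\lambda_{n-j+1}(\overline{G})|\big),$$ and let $f_{j}=\lim_{n\to\infty}f_{j}(n)/n$ and $f_{-j}=\lim_{n\to\infty}f_{-j}(n)/n$ (these limits exist). Thus $f_{-k+1}$ means $f_{-j}$ with $j=k-1$. *)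

theory Defs
  imports
    "Graph_Theory.Pair_Digraph"
    "Jordan_Normal_Form.Char_Poly"
    "HOL-Computational_Algebra.Computational_Algebra"
    "HOL-Library.Landau_Symbols"
begin

text \<open>
  A finite simple undirected graph is a \<open>pair_graph\<close>: finite, loop-free, and with a symmetric
  arc set, an edge \<open>uv\<close> being the two arcs \<open>(u, v)\<close> and \<open>(v, u)\<close>. The spectrum is invariant
  under isomorphism, so the maximum over all graphs of order \<open>n\<close> is taken over the graphs with
  vertex set \<open>{..<n}\<close>.
\<close>

definition graphs_of_order :: "nat \<Rightarrow> nat pair_pre_digraph set" where
  "graphs_of_order n = {G. pair_graph G \<and> pverts G = {..<n}}"

definition graph_complement :: "'a pair_pre_digraph \<Rightarrow> 'a pair_pre_digraph" where
  "graph_complement G =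
     \<lparr> pverts = pverts G,
       parcs = {(u, v). u \<in> pverts G \<and> v \<in> pverts G \<and> u \<noteq> v \<and> (u, v) \<notin> parcs G} \<rparr>"

text \<open>Meaningful for vertex sets of the form \<open>{..<n}\<close>.\<close>

definition adjacency_matrix :: "nat pair_pre_digraph \<Rightarrow> real mat" where
  "adjacency_matrix G =
     Matrix.mat (card (pverts G)) (card (pverts G)) (\<lambda>(u, v). if (u, v) \<in> parcs G then 1 else 0)"

text \<open>
  The eigenvalues with multiplicity are the real roots, with multiplicity, of the characteristic
  polynomial. For a graph of order \<open>n\<close> there are exactly \<open>n\<close> of them, because the adjacency
  matrix is real symmetric.
\<close>

definition eigenvalues_decreasing :: "nat pair_pre_digraph \<Rightarrow> real list" where
  "eigenvalues_decreasing G =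
     rev (sorted_list_of_multiset (proots (char_poly (adjacency_matrix G))))"

text \<open>The index \<open>j\<close> of \<open>graph_eigenvalue j G\<close> runs from \<open>1\<close> to the order of \<open>G\<close>.\<close>

definition graph_eigenvalue :: "nat \<Rightarrow> nat pair_pre_digraph \<Rightarrow> real" where
  "graph_eigenvalue j G = eigenvalues_decreasing G ! (j - 1)"

text \<open>
  The functions \<open>f\<^sub>j(n)\<close> and \<open>f\<^sub>-\<^sub>j(n)\<close>, meaningful for \<open>1 \<le> j \<le> n\<close>, and the limits \<open>f\<^sub>j\<close> and
  \<open>f\<^sub>-\<^sub>j\<close> of \<open>f\<^sub>j(n) / n\<close> and \<open>f\<^sub>-\<^sub>j(n) / n\<close>. The values at the finitely many \<open>n < j\<close> do not
  influence the limits.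
\<close>

definition f_pos_n :: "nat \<Rightarrow> nat \<Rightarrow> real" where
  "f_pos_n j n =
     Max ((\<lambda>G. graph_eigenvalue j G + graph_eigenvalue j (graph_complement G))
            ` graphs_of_order n)"

definition f_neg_n :: "nat \<Rightarrow> nat \<Rightarrow> real" where
  "f_neg_n j n =
     Max ((\<lambda>G. \<bar>graph_eigenvalue (n - j + 1) G\<bar> + \<bar>graph_eigenvalue (n - j + 1) (graph_complement G)\<bar>)
            ` graphs_of_order n)"

definition f_pos :: "nat \<Rightarrow> real" where
  "f_pos j = lim (\<lambda>n. f_pos_n j n / real n)"

definition f_neg :: "nat \<Rightarrow> real" where
  "f_neg j = lim (\<lambda>n. f_neg_n j n / real n)"

end

theory Submission
  imports Defs "HOL-Analysis.Function_Topology"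
begin

text \<open>
  Write \<open>A\<close> for the adjacency matrix of a graph of order \<open>n\<close>, \<open>J\<close> for the all-ones matrix, \<open>I\<close> for the
  identity, and \<open>B = A - J/2 + I/2\<close>. All off-diagonal entries of \<open>B\<close> are \<open>\<plusminus>1/2\<close>, and passing to the
  complementary graph replaces \<open>B\<close> by \<open>-B\<close>. So the problem is about how large eigenvalues of both
  signs a symmetric sign matrix can have.

  Upper bounds. \<open>J\<close> is positive semidefinite of rank one. Hence a positive eigenvalue number \<open>j + 1\<close> of \<open>A\<close>
  forces \<open>j\<close> eigenvalues of \<open>B\<close> of about that size, and a negative eigenvalue number \<open>j\<close> from the
  bottom forces \<open>j\<close> negative ones (\<open>eigenvalues_half_shift\<close>). The complement does the same at the
  opposite end of the spectrum of \<open>B\<close>. The squares of all eigenvalues of \<open>B\<close> add up to at most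
  \<open>n\<^sup>2/4\<close>, and with \<open>j\<close> eigenvalues at each end this limits the gap between the two ends to
  \<open>n / sqrt (2 j)\<close> (\<open>eigenvalue_gap_le\<close>).

  Existence of the limits. Replacing each vertex by \<open>t\<close> copies multiplies the relevant eigenvalues of
  a graph and of its complement by \<open>t\<close>, up to an error of \<open>t\<close> (\<open>graph_eigenvalue_blowup\<close>), so the
  maxima are almost supermultiplicative and an argument as in Fekete's lemma applies
  (\<open>supermultiplicative_limit\<close>). It shows also that every single graph gives a lower bound for the
  limit.

  Lower bounds. Equality in the upper bound would need a sign matrix of order \<open>n\<close> with exactly
  \<open>2 j\<close> nonzero eigenvalues, \<open>j\<close> of each sign and all of absolute value \<open>n / sqrt (2 j)\<close>. For a
  square \<open>j = q\<^sup>2\<close> there is such a matrix, by a construction of Kharaghani: take \<open>q\<close> orthogonal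
  sign vectors \<open>h\<^sub>c\<close> and place the rank one matrices \<open>h\<^sub>c h\<^sub>c\<^sup>T\<close> according to a symmetric Latin square of
  order \<open>q\<close>. Since the products of different \<open>h\<^sub>c h\<^sub>c\<^sup>T\<close> vanish, the square of the resulting
  matrix is a multiple of a projection of rank \<open>q\<^sup>2\<close>. Its tensor product with the \<open>2 \<times> 2\<close>
  Hadamard matrix has \<open>q\<^sup>2\<close> positive and \<open>q\<^sup>2\<close> negative eigenvalues of equal size, and since the
  \<open>h\<^sub>c\<close> are chosen orthogonal to the all-ones vector, this vector supplies the eigenvalue number \<open>q\<^sup>2 + 1\<close>
  from the top (\<open>eigenvalues_signed_graph\<close>). For arbitrary \<open>j = k - 1\<close> one takes
  \<open>q = \<lceil>sqrt j\<rceil> < sqrt j + 1\<close>, and \<open>1 / (sqrt 2 q)\<close> exceeds the asserted bound.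
\<close>

section \<open>The spectral theorem for real symmetric matrices\<close>

text \<open>
  Vectors are functions on \<open>nat\<close> and matrices are binary functions, of which only the values at
  indices below \<open>n\<close> count. In this form the order of a matrix is an ordinary variable, and the product
  topology on functions gives the compactness that the spectral theorem needs.
\<close>

definition inner_upto :: "nat \<Rightarrow> (nat \<Rightarrow> real) \<Rightarrow> (nat \<Rightarrow> real) \<Rightarrow> real" where
  "inner_upto n x y = (\<Sum>i<n. x i * y i)"

definition mult_upto :: "nat \<Rightarrow> (nat \<Rightarrow> nat \<Rightarrow> real) \<Rightarrow> (nat \<Rightarrow> real) \<Rightarrow> nat \<Rightarrow> real" where
  "mult_upto n a x i = (\<Sum>j<n. a i j * x j)"

definition quad_form :: "nat \<Rightarrow> (nat \<Rightarrow> nat \<Rightarrow> real) \<Rightarrow> (nat \<Rightarrow> real) \<Rightarrow> real" where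
  "quad_form n a x = inner_upto n x (mult_upto n a x)"

definition symmetric_upto :: "nat \<Rightarrow> (nat \<Rightarrow> nat \<Rightarrow> real) \<Rightarrow> bool" where
  "symmetric_upto n a \<longleftrightarrow> (\<forall>i<n. \<forall>j<n. a i j = a j i)"

text \<open>
  The eigenvalues are listed in decreasing order from index \<open>0\<close>; thus \<open>e p\<close> is the eigenvalue with
  number \<open>p + 1\<close> from the top and \<open>e (n - 1 - p)\<close> the one with number \<open>p + 1\<close> from the bottom.
\<close>

definition eigenbasis ::
  "nat \<Rightarrow> (nat \<Rightarrow> nat \<Rightarrow> real) \<Rightarrow> (nat \<Rightarrow> real) \<Rightarrow> (nat \<Rightarrow> nat \<Rightarrow> real) \<Rightarrow> bool" where
  "eigenbasis n a e u \<longleftrightarrow>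
     (\<forall>p<n. \<forall>r<n. inner_upto n (u p) (u r) = (if p = r then 1 else 0)) \<and>
     (\<forall>p<n. \<forall>i<n. mult_upto n a (u p) i = e p * u p i) \<and>
     (\<forall>p r. p \<le> r \<longrightarrow> r < n \<longrightarrow> e r \<le> e p)"

lemma inner_upto_commute: "inner_upto n x y = inner_upto n y x"
  by (simp add: inner_upto_def mult.commute)

lemma inner_upto_add_right:
  "inner_upto n x (\<lambda>i. y i + t * z i) = inner_upto n x y + t * inner_upto n x z"
  by (simp add: inner_upto_def algebra_simps sum.distrib sum_distrib_left)

lemma inner_upto_add_left:
  "inner_upto n (\<lambda>i. y i + t * z i) x = inner_upto n y x + t * inner_upto n z x"
  by (simp add: inner_upto_def algebra_simps sum.distrib sum_distrib_left)

lemma inner_upto_sum_right: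
  "inner_upto n x (\<lambda>i. \<Sum>k\<in>K. c k * y k i) = (\<Sum>k\<in>K. c k * inner_upto n x (y k))"
  unfolding inner_upto_def sum_distrib_left
  by (subst sum.swap) (simp add: mult_ac)

lemma inner_upto_cong:
  "(\<And>i. i < n \<Longrightarrow> x i = x' i) \<Longrightarrow> (\<And>i. i < n \<Longrightarrow> y i = y' i) \<Longrightarrow> inner_upto n x y = inner_upto n x' y'"
  by (simp add: inner_upto_def)

lemma inner_upto_nonneg: "0 \<le> inner_upto n x x"
  by (simp add: inner_upto_def sum_nonneg)

lemma inner_upto_eq_0: "inner_upto n x x = 0 \<Longrightarrow> i < n \<Longrightarrow> x i = 0"
  unfolding inner_upto_def by (subst (asm) sum_nonneg_eq_0_iff) auto

lemma mult_upto_add: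
  "mult_upto n a (\<lambda>i. y i + t * z i) = (\<lambda>i. mult_upto n a y i + t * mult_upto n a z i)"
  by (simp add: mult_upto_def fun_eq_iff algebra_simps sum.distrib sum_distrib_left)

lemma inner_mult_symmetric:
  assumes "symmetric_upto n a"
  shows "inner_upto n x (mult_upto n a y) = inner_upto n (mult_upto n a x) y"
proof -
  have "inner_upto n x (mult_upto n a y) = (\<Sum>i<n. \<Sum>j<n. a i j * x i * y j)"
    by (simp add: inner_upto_def mult_upto_def sum_distrib_left mult_ac)
  also have "\<dots> = (\<Sum>j<n. \<Sum>i<n. a i j * x i * y j)" by (rule sum.swap)
  also have "\<dots> = (\<Sum>j<n. \<Sum>i<n. a j i * x i * y j)"
    using assms by (intro sum.cong) (auto simp: symmetric_upto_def)
  finally show ?thesis by (simp add: inner_upto_def mult_upto_def sum_distrib_right)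
qed

lemma quad_form_add:
  assumes "symmetric_upto n a"
  shows "quad_form n a (\<lambda>i. x i + t * w i) =
    quad_form n a x + 2 * t * inner_upto n (mult_upto n a x) w + t\<^sup>2 * quad_form n a w"
proof -
  have *: "inner_upto n x (mult_upto n a w) = inner_upto n (mult_upto n a x) w"
    using assms by (rule inner_mult_symmetric)
  have **: "inner_upto n w (mult_upto n a x) = inner_upto n (mult_upto n a x) w"
    by (rule inner_upto_commute)
  show ?thesis
    by (simp add: quad_form_def mult_upto_add inner_upto_add_right inner_upto_add_left * ** power2_eq_square algebra_simps)
qed

lemma quad_form_scale: "quad_form n a (\<lambda>i. c * x i) = c\<^sup>2 * quad_form n a x"
  by (simp add: quad_form_def inner_upto_def mult_upto_def sum_distrib_left power2_eq_square mult_ac)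

lemma inner_upto_scale: "inner_upto n (\<lambda>i. c * x i) (\<lambda>i. d * y i) = c * d * inner_upto n x y"
  by (simp add: inner_upto_def sum_distrib_left mult_ac)

lemma quad_form_cong:
  "(\<And>i. i < n \<Longrightarrow> x i = y i) \<Longrightarrow> quad_form n a x = quad_form n a y"
  unfolding quad_form_def by (rule inner_upto_cong) (auto simp: mult_upto_def)

text \<open>
  Gaussian elimination: an equation with a nonzero coefficient is solved for one unknown, which is then
  eliminated from the other equations. It yields the nonzero vectors that the min-max principle needs.
\<close>

lemma homogeneous_system_nontrivial_solution:
  fixes a :: "'j \<Rightarrow> 'i \<Rightarrow> real"
  assumes "finite J" "finite I" "card J < card I"
  shows "\<exists>c. (\<exists>i\<in>I. c i \<noteq> 0) \<and> (\<forall>j\<in>J. (\<Sum>i\<in>I. a j i * c i) = 0)"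
  using assms
proof (induction J arbitrary: I a rule: finite_induct)
  case empty
  then have "I \<noteq> {}" by auto
  then show ?case by (intro exI[of _ "\<lambda>_. 1"]) auto
next
  case (insert j J)
  show ?case
  proof (cases "\<forall>i\<in>I. a j i = 0")
    case True
    from insert have "card J < card I" by simp
    from insert.IH[OF \<open>finite I\<close> this, of a] True show ?thesis by auto
  next
    case False
    then obtain i0 where i0: "i0 \<in> I" "a j i0 \<noteq> 0" by auto
    let ?I = "I - {i0}"
    \<comment> \<open>Solve equation \<open>j\<close> for the unknown \<open>i0\<close> and substitute.\<close>
    let ?b = "\<lambda>k i. a k i - a k i0 * a j i / a j i0"
    have "finite ?I" "card J < card ?I" using insert i0 by auto
    from insert.IH[OF this, of ?b] obtain c where
      c: "\<exists>i\<in>?I. c i \<noteq> 0" "\<And>k. k \<in> J \<Longrightarrow> (\<Sum>i\<in>?I. ?b k i * c i) = 0" by blast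
    let ?s = "\<Sum>i\<in>?I. a j i * c i"
    let ?c = "c(i0 := - ?s / a j i0)"
    have split: "(\<Sum>i\<in>I. a k i * ?c i) = (\<Sum>i\<in>?I. a k i * c i) - a k i0 * ?s / a j i0" for k
      using i0 \<open>finite I\<close> by (subst sum.remove[of I i0]) auto
    have "(\<Sum>i\<in>I. a k i * ?c i) = 0" if "k \<in> insert j J" for k
    proof (cases "k = j")
      case True
      then show ?thesis using split[of j] i0 by simp
    next
      case False
      then have "k \<in> J" using that by auto
      have "(\<Sum>i\<in>?I. ?b k i * c i) = (\<Sum>i\<in>?I. a k i * c i) - a k i0 / a j i0 * ?s"
        unfolding sum_distrib_left sum_subtractf[symmetric]
        by (rule sum.cong) (auto simp: algebra_simps)
      then show ?thesis using split[of k] c(2)[OF \<open>k \<in> J\<close>] by simp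
    qed
    moreover have "\<exists>i\<in>I. ?c i \<noteq> 0" using c(1) by auto
    ultimately show ?thesis by blast
  qed
qed

text \<open>
  Demanding that a vector vanishes from index \<open>n\<close> on makes this set compact.
\<close>

definition unit_sphere_orth :: "nat \<Rightarrow> (nat \<Rightarrow> nat \<Rightarrow> real) \<Rightarrow> nat \<Rightarrow> (nat \<Rightarrow> real) set" where
  "unit_sphere_orth n u m =
     {x. (\<forall>i\<ge>n. x i = 0) \<and> inner_upto n x x = 1 \<and> (\<forall>p<m. inner_upto n (u p) x = 0)}"

lemma continuous_on_inner_upto:
  "continuous_on UNIV f \<Longrightarrow> continuous_on UNIV g \<Longrightarrow>
   continuous_on UNIV (\<lambda>x::nat \<Rightarrow> real. inner_upto n (f x) (g x))"
  unfolding inner_upto_def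
  by (intro continuous_on_sum continuous_on_mult; erule continuous_on_product_then_coordinatewise)

lemma continuous_on_quad_form: "continuous_on UNIV (\<lambda>x::nat \<Rightarrow> real. quad_form n a x)"
  unfolding quad_form_def inner_upto_def mult_upto_def
  by (intro continuous_intros continuous_on_product_coordinates)

lemma compact_unit_sphere_orth: "compact (unit_sphere_orth n u m)"
proof -
  let ?B = "PiE UNIV (\<lambda>i::nat. if i < n then {-1..1::real} else {0})"
  have "compactin (product_topology (\<lambda>i. euclidean) UNIV) ?B"
    by (subst compactin_PiE) auto
  then have B: "compact ?B" by (simp add: euclidean_product_topology)
  have cl: "closed {x. inner_upto n x x = 1 \<and> (\<forall>p<m. inner_upto n (u p) x = 0)}"
  proof (intro closed_Collect_conj closed_Collect_all closed_Collect_imp closed_Collect_eq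
      continuous_on_inner_upto continuous_on_id continuous_on_const)
  qed auto
  have "unit_sphere_orth n u m = ?B \<inter> {x. inner_upto n x x = 1 \<and> (\<forall>p<m. inner_upto n (u p) x = 0)}"
  proof -
    have "x i \<in> {-1..1}" if "inner_upto n x x = 1" "i < n" for x i
    proof -
      have "x i * x i \<le> inner_upto n x x"
        unfolding inner_upto_def by (rule member_le_sum) (use that in auto)
      then have "(x i)\<^sup>2 \<le> 1" using that by (simp add: power2_eq_square)
      then show ?thesis by (simp add: abs_square_le_1 abs_le_iff)
    qed
    then show ?thesis unfolding unit_sphere_orth_def by (auto simp: PiE_iff split: if_splits)
  qed
  then show ?thesis using compact_Int_closed[OF B cl] by simp
qed

lemma unit_sphere_orth_nonempty:
  assumes "m < n"
  shows "unit_sphere_orth n u m \<noteq> {}"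
proof -
  obtain c where c: "\<exists>i\<in>{..<n}. c i \<noteq> 0" "\<And>p. p < m \<Longrightarrow> (\<Sum>i<n. u p i * c i) = 0"
    using homogeneous_system_nontrivial_solution[of "{..<m}" "{..<n}" u] assms by auto
  let ?s = "inner_upto n c c"
  let ?x = "\<lambda>i. if i < n then 1 / sqrt ?s * c i else 0"
  have "?s \<noteq> 0" using c(1) inner_upto_eq_0 by blast
  then have s: "?s > 0" using inner_upto_nonneg[of n c] by linarith
  have "inner_upto n ?x ?x = inner_upto n (\<lambda>i. 1 / sqrt ?s * c i) (\<lambda>i. 1 / sqrt ?s * c i)"
    by (rule inner_upto_cong) auto
  also have "\<dots> = 1" using s by (subst inner_upto_scale) (simp add: field_simps)
  finally have "inner_upto n ?x ?x = 1" .
  moreover have "inner_upto n (u p) ?x = 0" if "p < m" for p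
  proof -
    have "inner_upto n (u p) ?x = inner_upto n (\<lambda>i. 1 * u p i) (\<lambda>i. 1 / sqrt ?s * c i)"
      by (rule inner_upto_cong) auto
    also have "\<dots> = 0" using c(2)[OF that] by (subst inner_upto_scale) (simp add: inner_upto_def)
    finally show ?thesis .
  qed
  ultimately have "?x \<in> unit_sphere_orth n u m" by (simp add: unit_sphere_orth_def)
  then show ?thesis by blast
qed

text \<open>
  The first-order condition at a maximum, in the form in which it is used below.
\<close>

lemma zero_of_linear_plus_quadratic_nonpos:
  fixes b c :: real
  assumes "\<And>t. 2 * t * b + t\<^sup>2 * c \<le> 0"
  shows "b = 0"
proof (rule ccontr)
  assume b: "b \<noteq> 0"
  define d where "d = 1 + \<bar>c\<bar>"
  have d: "d > 0" "2 * d + c > 0" by (auto simp: d_def)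
  have "2 * (b / d) * b + (b / d)\<^sup>2 * c = b\<^sup>2 / d\<^sup>2 * (2 * d + c)"
    using d by (simp add: field_simps power2_eq_square)
  moreover have "b\<^sup>2 / d\<^sup>2 * (2 * d + c) > 0" using b d by (intro mult_pos_pos) auto
  ultimately show False using assms[of "b / d"] by linarith
qed

text \<open>
  Let \<open>\<mu>\<close> be the maximal value. The residual \<open>g = a x - \<mu> x\<close> is again orthogonal to the previous
  eigenvectors, because \<open>a\<close> is symmetric, so \<open>x + t g\<close> is an admissible competitor for every \<open>t\<close>. The
  derivative at \<open>t = 0\<close> of the difference between the quadratic form and \<open>\<mu>\<close> times the squared norm is twice the
  squared norm of \<open>g\<close>; as this difference is maximal at \<open>t = 0\<close>, the residual vanishes.
\<close>

lemma rayleigh_maximizer_is_eigenvector: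
  assumes sym: "symmetric_upto n a"
    and eig: "\<And>p i. p < m \<Longrightarrow> i < n \<Longrightarrow> mult_upto n a (u p) i = e p * u p i"
    and x: "x \<in> unit_sphere_orth n u m"
    and max: "\<And>y. y \<in> unit_sphere_orth n u m \<Longrightarrow> quad_form n a y \<le> quad_form n a x"
    and i: "i < n"
  shows "mult_upto n a x i = quad_form n a x * x i"
proof -
  define \<mu> where "\<mu> = quad_form n a x"
  have bound: "quad_form n a y \<le> \<mu> * inner_upto n y y"
    if orth: "\<And>p. p < m \<Longrightarrow> inner_upto n (u p) y = 0" for y
  proof (cases "inner_upto n y y = 0")
    case True
    then have "\<And>i. i < n \<Longrightarrow> y i = 0" using inner_upto_eq_0 by blast
    then have "quad_form n a y = 0" by (simp add: quad_form_def inner_upto_def)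
    then show ?thesis using True by simp
  next
    case False
    let ?s = "inner_upto n y y"
    from False have s: "?s > 0" using inner_upto_nonneg[of n y] by linarith
    let ?z = "\<lambda>i. if i < n then 1 / sqrt ?s * y i else 0"
    have "inner_upto n ?z ?z = inner_upto n (\<lambda>i. 1 / sqrt ?s * y i) (\<lambda>i. 1 / sqrt ?s * y i)"
      by (rule inner_upto_cong) auto
    also have "\<dots> = 1" using s by (subst inner_upto_scale) (simp add: field_simps)
    finally have "inner_upto n ?z ?z = 1" .
    moreover have "inner_upto n (u p) ?z = 0" if "p < m" for p
    proof -
      have "inner_upto n (u p) ?z = inner_upto n (\<lambda>i. 1 * u p i) (\<lambda>i. 1 / sqrt ?s * y i)"
        by (rule inner_upto_cong) auto
      also have "\<dots> = 0" using orth[OF that] by (subst inner_upto_scale) simp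
      finally show ?thesis .
    qed
    ultimately have "?z \<in> unit_sphere_orth n u m" by (simp add: unit_sphere_orth_def)
    from max[OF this] have "quad_form n a ?z \<le> \<mu>" by (simp add: \<mu>_def)
    moreover have "quad_form n a ?z = quad_form n a (\<lambda>i. 1 / sqrt ?s * y i)"
      by (rule quad_form_cong) auto
    ultimately have "(1 / sqrt ?s)\<^sup>2 * quad_form n a y \<le> \<mu>"
      by (simp only: quad_form_scale)
    then have "quad_form n a y / ?s \<le> \<mu>" using s by (simp add: power_divide)
    then show ?thesis using s by (simp add: field_simps)
  qed
  let ?g = "\<lambda>i. mult_upto n a x i + (- \<mu>) * x i"
  have orth_x: "inner_upto n (u p) x = 0" if "p < m" for p
    using x that by (simp add: unit_sphere_orth_def)
  have orth_g: "inner_upto n (u p) ?g = 0" if "p < m" for p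
  proof -
    have "inner_upto n (u p) (mult_upto n a x) = inner_upto n (mult_upto n a (u p)) x"
      by (rule inner_mult_symmetric[OF sym])
    also have "\<dots> = inner_upto n (\<lambda>i. e p * u p i) (\<lambda>i. 1 * x i)"
      by (rule inner_upto_cong) (auto simp: eig that)
    also have "\<dots> = 0" using orth_x[OF that] by (subst inner_upto_scale) simp
    finally show ?thesis by (simp only: inner_upto_add_right orth_x[OF that])
  qed
  have gg: "inner_upto n ?g ?g = inner_upto n (mult_upto n a x) ?g - \<mu> * inner_upto n x ?g"
    by (subst inner_upto_add_left) simp
  have "2 * t * inner_upto n ?g ?g + t\<^sup>2 * (quad_form n a ?g - \<mu> * inner_upto n ?g ?g) \<le> 0" for t
  proof -
    let ?y = "\<lambda>i. x i + t * ?g i"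
    have le: "quad_form n a ?y \<le> \<mu> * inner_upto n ?y ?y"
    proof (rule bound)
      fix p assume "p < m"
      then show "inner_upto n (u p) ?y = 0"
        by (simp only: inner_upto_add_right[where y = x and z = ?g] orth_x orth_g)
    qed
    have norm: "inner_upto n ?y ?y = 1 + 2 * t * inner_upto n x ?g + t\<^sup>2 * inner_upto n ?g ?g"
    proof -
      have "inner_upto n ?y ?y = inner_upto n x x + 2 * t * inner_upto n x ?g + t\<^sup>2 * inner_upto n ?g ?g"
        by (simp only: inner_upto_add_left[where y = x and z = ?g] inner_upto_add_right[where y = x and z = ?g]
            inner_upto_commute[of n ?g x]) (simp add: power2_eq_square algebra_simps)
      then show ?thesis using x by (simp add: unit_sphere_orth_def)
    qed
    have quad: "quad_form n a ?y = \<mu> + 2 * t * inner_upto n (mult_upto n a x) ?g + t\<^sup>2 * quad_form n a ?g"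
      unfolding \<mu>_def by (rule quad_form_add[OF sym])
    have "2 * t * G + t\<^sup>2 * (Q - \<mu> * G) \<le> 0"
      if "q \<le> \<mu> * N" "N = 1 + 2 * t * X + t\<^sup>2 * G" "q = \<mu> + 2 * t * M + t\<^sup>2 * Q" "G = M - \<mu> * X"
      for q N G Q M X :: real
    proof -
      have "2 * t * G + t\<^sup>2 * (Q - \<mu> * G) = q - \<mu> * N"
        unfolding that(2,3) by (simp add: that(4) algebra_simps)
      then show ?thesis using that(1) by simp
    qed
    from this[OF le norm quad gg] show ?thesis .
  qed
  then have "inner_upto n ?g ?g = 0" by (rule zero_of_linear_plus_quadratic_nonpos)
  from inner_upto_eq_0[OF this i] show ?thesis by (simp add: \<mu>_def)
qed

text \<open>
  The eigenvectors are chosen one after the other as maximizers of the quadratic form on the part of the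
  unit sphere orthogonal to the previous ones. These parts decrease, and therefore so do the eigenvalues.
\<close>

theorem ex_eigenbasis:
  assumes sym: "symmetric_upto n a"
  shows "\<exists>e u. eigenbasis n a e u"
proof -
  define P where "P m u \<longleftrightarrow> (\<forall>p<m. u p \<in> unit_sphere_orth n u p \<and>
     (\<forall>y \<in> unit_sphere_orth n u p. quad_form n a y \<le> quad_form n a (u p)))" for m u
  have "m \<le> n \<Longrightarrow> \<exists>u. P m u" for m
  proof (induction m)
    case 0
    show ?case by (simp add: P_def)
  next
    case (Suc m)
    then obtain u where u: "P m u" by auto
    obtain x where x: "x \<in> unit_sphere_orth n u m"
      "\<And>y. y \<in> unit_sphere_orth n u m \<Longrightarrow> quad_form n a y \<le> quad_form n a x"
      using continuous_attains_sup[OF compact_unit_sphere_orth unit_sphere_orth_nonempty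
          continuous_on_subset[OF continuous_on_quad_form]] Suc.prems
      by (metis Suc_le_eq subset_UNIV)
    have "unit_sphere_orth n (u(m := x)) p = unit_sphere_orth n u p" if "p \<le> m" for p
      using that by (auto simp: unit_sphere_orth_def)
    then have "P (Suc m) (u(m := x))" using u x by (auto simp: P_def less_Suc_eq)
    then show ?case by blast
  qed
  then obtain u where u: "P n u" by blast
  define e where "e p = quad_form n a (u p)" for p
  have eig: "mult_upto n a (u p) i = e p * u p i" if "p < n" "i < n" for p i
    using that
  proof (induction p arbitrary: i rule: less_induct)
    case (less p)
    show ?case unfolding e_def
      by (rule rayleigh_maximizer_is_eigenvector[OF sym, where m = p and u = u and e = e])
        (use less u in \<open>auto simp: P_def\<close>)
  qed
  have orth: "inner_upto n (u p) (u r) = 0" if "p < r" "r < n" for p r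
    using u that by (auto simp: P_def unit_sphere_orth_def)
  have "inner_upto n (u p) (u r) = (if p = r then 1 else 0)" if "p < n" "r < n" for p r
    using orth[of p r] orth[of r p] that u inner_upto_commute[of n "u p" "u r"]
    by (cases p r rule: linorder_cases) (auto simp: P_def unit_sphere_orth_def)
  moreover have "e r \<le> e p" if "p \<le> r" "r < n" for p r
  proof -
    have "u r \<in> unit_sphere_orth n u p" using u that by (auto simp: P_def unit_sphere_orth_def)
    then show ?thesis using u that by (auto simp: P_def e_def)
  qed
  ultimately have "eigenbasis n a e u" using eig by (auto simp: eigenbasis_def)
  then show ?thesis by blast
qed

text \<open>
  For square matrices a left inverse is a right inverse: orthonormal columns give orthonormal rows.
\<close>

lemma eigenbasis_complete:
  assumes "eigenbasis n a e u" "i < n" "j < n"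
  shows "(\<Sum>p<n. u p i * u p j) = (if i = j then 1 else 0)"
proof -
  let ?U = "Matrix.mat n n (\<lambda>(i, p). u p i)" and ?V = "Matrix.mat n n (\<lambda>(p, i). u p i)"
  have "?V * ?U = 1\<^sub>m n"
    using assms(1) by (intro eq_matI) (auto simp: scalar_prod_def eigenbasis_def inner_upto_def lessThan_atLeast0)
  then have "?U * ?V = 1\<^sub>m n" by (intro mat_mult_left_right_inverse[of ?V n ?U]) auto
  then have "(?U * ?V) $$ (i, j) = (1\<^sub>m n :: real mat) $$ (i, j)" by simp
  then show ?thesis using assms(2,3) by (simp add: scalar_prod_def lessThan_atLeast0)
qed

lemma eigenbasis_expansion:
  assumes "eigenbasis n a e u" "i < n"
  shows "x i = (\<Sum>p<n. inner_upto n (u p) x * u p i)"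
proof -
  have "(\<Sum>p<n. inner_upto n (u p) x * u p i) = (\<Sum>p<n. \<Sum>j<n. x j * (u p j * u p i))"
    by (simp add: inner_upto_def sum_distrib_right sum_distrib_left mult_ac)
  also have "\<dots> = (\<Sum>j<n. x j * (\<Sum>p<n. u p j * u p i))"
    by (subst sum.swap) (simp add: sum_distrib_left)
  also have "\<dots> = (\<Sum>j<n. if j = i then x j else 0)"
    using eigenbasis_complete[OF assms(1) _ assms(2)] by (intro sum.cong) auto
  also have "\<dots> = x i" using assms(2) by simp
  finally show ?thesis by simp
qed

lemma eigenbasis_parseval:
  assumes "eigenbasis n a e u"
  shows "inner_upto n x y = (\<Sum>p<n. inner_upto n (u p) x * inner_upto n (u p) y)"
proof -
  have "inner_upto n y x = inner_upto n y (\<lambda>i. \<Sum>p<n. inner_upto n (u p) x * u p i)"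
    by (rule inner_upto_cong) (simp_all add: eigenbasis_expansion[OF assms, symmetric])
  also have "\<dots> = (\<Sum>p<n. inner_upto n (u p) x * inner_upto n (u p) y)"
    by (simp add: inner_upto_sum_right inner_upto_commute[of n y])
  finally show ?thesis by (simp add: inner_upto_commute)
qed

lemma eigenbasis_mult_coordinate:
  assumes "symmetric_upto n a" "eigenbasis n a e u" "p < n"
  shows "inner_upto n (u p) (mult_upto n a x) = e p * inner_upto n (u p) x"
proof -
  have "inner_upto n (u p) (mult_upto n a x) = inner_upto n (mult_upto n a (u p)) x"
    by (rule inner_mult_symmetric[OF assms(1)])
  also have "\<dots> = inner_upto n (\<lambda>i. e p * u p i) (\<lambda>i. 1 * x i)"
    using assms(2,3) by (intro inner_upto_cong) (auto simp: eigenbasis_def)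
  also have "\<dots> = e p * inner_upto n (u p) x" by (subst inner_upto_scale) simp
  finally show ?thesis .
qed

lemma quad_form_eigenbasis:
  assumes "symmetric_upto n a" "eigenbasis n a e u"
  shows "quad_form n a x = (\<Sum>p<n. e p * (inner_upto n (u p) x)\<^sup>2)"
  unfolding quad_form_def
  by (subst eigenbasis_parseval[OF assms(2)])
    (simp add: eigenbasis_mult_coordinate[OF assms] power2_eq_square mult_ac)

text \<open>
  Both sides are the squared Frobenius norm. It is computed row by row: the coordinates of row \<open>i\<close> in
  the eigenbasis are \<open>e p * u p i\<close>, because the matrix maps \<open>u p\<close> to \<open>e p\<close> times itself.
\<close>

lemma sum_eigenvalues_squared:
  assumes "symmetric_upto n a" "eigenbasis n a e u"
  shows "(\<Sum>p<n. (e p)\<^sup>2) = (\<Sum>i<n. \<Sum>j<n. (a i j)\<^sup>2)"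
proof -
  have 1: "(\<Sum>j<n. (a i j)\<^sup>2) = (\<Sum>p<n. (e p)\<^sup>2 * (u p i)\<^sup>2)" if "i < n" for i
  proof -
    have "(\<Sum>j<n. (a i j)\<^sup>2) = inner_upto n (a i) (a i)"
      by (simp add: inner_upto_def power2_eq_square)
    also have "\<dots> = (\<Sum>p<n. (inner_upto n (u p) (a i))\<^sup>2)"
      by (subst eigenbasis_parseval[OF assms(2)]) (simp add: power2_eq_square)
    also have "\<dots> = (\<Sum>p<n. (e p)\<^sup>2 * (u p i)\<^sup>2)"
    proof (rule sum.cong)
      fix p assume "p \<in> {..<n}"
      then have "inner_upto n (u p) (a i) = e p * u p i"
        using assms(2) that unfolding eigenbasis_def
        by (subst inner_upto_commute) (simp add: inner_upto_def mult_upto_def)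
      then show "(inner_upto n (u p) (a i))\<^sup>2 = (e p)\<^sup>2 * (u p i)\<^sup>2" by (simp add: power_mult_distrib)
    qed simp
    finally show ?thesis .
  qed
  have "(\<Sum>i<n. \<Sum>j<n. (a i j)\<^sup>2) = (\<Sum>i<n. \<Sum>p<n. (e p)\<^sup>2 * (u p i)\<^sup>2)"
    by (rule sum.cong) (simp_all only: 1 lessThan_iff)
  also have "\<dots> = (\<Sum>p<n. (e p)\<^sup>2 * inner_upto n (u p) (u p))"
    by (subst sum.swap) (simp add: inner_upto_def sum_distrib_left power2_eq_square)
  also have "\<dots> = (\<Sum>p<n. (e p)\<^sup>2)" using assms(2) by (simp add: eigenbasis_def)
  finally show ?thesis by simp
qed

lemma eigenbasis_uminus:
  assumes "eigenbasis n a e u"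
  shows "eigenbasis n (\<lambda>i j. - a i j) (\<lambda>p. - e (n - 1 - p)) (\<lambda>p. u (n - 1 - p))"
  using assms unfolding eigenbasis_def
  by (auto simp: mult_upto_def sum_negf)

section \<open>The min-max principle\<close>

text \<open>
  One half of the Courant-Fischer theorem, for the subspace of the combinations of the \<open>w i\<close> that are orthogonal to
  all \<open>z k\<close>. The constraints \<open>z k\<close> make it possible to argue with a subspace that is given by equations without
  choosing a basis of it. Requiring orthogonality to the first \<open>p\<close> eigenvectors as well still leaves a
  nonzero vector, and on such vectors the Rayleigh quotient is at most \<open>e p\<close>.
\<close>

lemma eigenvalue_ge_of_subspace:
  assumes sym: "symmetric_upto n a" and eb: "eigenbasis n a e u"
    and fin: "finite I" "finite K" and p: "p < n" "p + card K < card I"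
    and large: "\<And>c v. \<exists>i\<in>I. c i \<noteq> 0 \<Longrightarrow> v = (\<lambda>t. \<Sum>i\<in>I. c i * w i t) \<Longrightarrow>
        (\<And>k. k \<in> K \<Longrightarrow> inner_upto n (z k) v = 0) \<Longrightarrow>
        0 < inner_upto n v v \<and> x * inner_upto n v v \<le> quad_form n a v"
  shows "x \<le> e p"
proof (rule ccontr)
  assume "\<not> x \<le> e p"
  then have less: "e p < x" by simp
  \<comment> \<open>One equation for each of the first \<open>p\<close> eigenvectors and one for each constraint.\<close>
  define f where "f = (\<lambda>j i. inner_upto n (case j of Inl r \<Rightarrow> u r | Inr k \<Rightarrow> z k) (w i))"
  have "card ({..<p} <+> K) < card I" using p fin by (simp add: card_Plus)
  from homogeneous_system_nontrivial_solution[OF _ fin(1) this, of f] fin obtain c where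
    c: "\<exists>i\<in>I. c i \<noteq> 0" "\<And>j. j \<in> {..<p} <+> K \<Longrightarrow> (\<Sum>i\<in>I. f j i * c i) = 0"
    by (metis finite_Plus finite_lessThan)
  define v where "v = (\<lambda>t. \<Sum>i\<in>I. c i * w i t)"
  have u0: "inner_upto n (u r) v = 0" if "r < p" for r
    using c(2)[OF InlI[of r]] that unfolding v_def inner_upto_sum_right by (simp add: f_def mult.commute)
  have "inner_upto n (z k) v = 0" if "k \<in> K" for k
    using c(2)[OF InrI[of k]] that unfolding v_def inner_upto_sum_right by (simp add: f_def mult.commute)
  with large[OF c(1) v_def] have v: "0 < inner_upto n v v" "x * inner_upto n v v \<le> quad_form n a v"
    by auto
  have "quad_form n a v = (\<Sum>r<n. e r * (inner_upto n (u r) v)\<^sup>2)"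
    by (rule quad_form_eigenbasis[OF sym eb])
  also have "\<dots> \<le> (\<Sum>r<n. e p * (inner_upto n (u r) v)\<^sup>2)"
  proof (rule sum_mono)
    fix r assume "r \<in> {..<n}"
    then show "e r * (inner_upto n (u r) v)\<^sup>2 \<le> e p * (inner_upto n (u r) v)\<^sup>2"
      using u0[of r] eb unfolding eigenbasis_def
      by (cases "r < p") (auto intro!: mult_right_mono)
  qed
  also have "\<dots> = e p * inner_upto n v v"
    unfolding sum_distrib_left[symmetric]
    by (subst eigenbasis_parseval[OF eb, of v v]) (simp add: power2_eq_square)
  also have "\<dots> < x * inner_upto n v v" using less v by simp
  finally show False using v by simp
qed

lemma quad_form_uminus: "quad_form n (\<lambda>i j. - a i j) x = - quad_form n a x"
  by (simp add: quad_form_def inner_upto_def mult_upto_def sum_negf)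

lemma eigenvalue_le_of_subspace:
  assumes sym: "symmetric_upto n a" and eb: "eigenbasis n a e u"
    and fin: "finite I" and p: "p < n" "p < card I"
    and small: "\<And>c v. \<exists>i\<in>I. c i \<noteq> 0 \<Longrightarrow> v = (\<lambda>t. \<Sum>i\<in>I. c i * w i t) \<Longrightarrow>
        0 < inner_upto n v v \<and> quad_form n a v \<le> x * inner_upto n v v"
  shows "e (n - 1 - p) \<le> x"
proof -
  have "- x \<le> - e (n - 1 - p)"
  proof (rule eigenvalue_ge_of_subspace[OF _ eigenbasis_uminus[OF eb] fin, where K = "{}" and w = w])
    show "symmetric_upto n (\<lambda>i j. - a i j)" using sym by (simp add: symmetric_upto_def)
    fix c v assume "\<exists>i\<in>I. c i \<noteq> 0" "v = (\<lambda>t. \<Sum>i\<in>I. c i * w i t)"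
    from small[OF this]
    show "0 < inner_upto n v v \<and> - x * inner_upto n v v \<le> quad_form n (\<lambda>i j. - a i j) v"
      by (simp add: quad_form_uminus)
  qed (use p in auto)
  then show ?thesis by simp
qed

text \<open>
  These subspaces are the ones to which the min-max principle is applied when the eigenvalues of two matrices
  are compared.
\<close>

lemma span_first_eigenvectors:
  assumes "symmetric_upto n a" "eigenbasis n a e u" "k < n"
    and "\<exists>i\<in>{..k}. c i \<noteq> 0" "v = (\<lambda>t. \<Sum>i\<le>k. c i * u i t)"
  shows "0 < inner_upto n v v" "e k * inner_upto n v v \<le> quad_form n a v"
proof -
  have coord: "inner_upto n (u p) v = (if p \<le> k then c p else 0)" if "p < n" for p
  proof -
    have "inner_upto n (u p) v = (\<Sum>i\<le>k. c i * inner_upto n (u p) (u i))"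
      unfolding assms(5) by (rule inner_upto_sum_right)
    also have "\<dots> = (\<Sum>i\<le>k. if p = i then c i else 0)"
      using assms(2,3) that unfolding eigenbasis_def by (intro sum.cong) auto
    also have "\<dots> = (if p \<le> k then c p else 0)" by simp
    finally show ?thesis .
  qed
  have vv: "inner_upto n v v = (\<Sum>p<n. (inner_upto n (u p) v)\<^sup>2)"
    by (subst eigenbasis_parseval[OF assms(2)]) (simp add: power2_eq_square)
  obtain i where i: "i \<le> k" "c i \<noteq> 0" using assms(4) by auto
  have "(inner_upto n (u i) v)\<^sup>2 \<le> inner_upto n v v"
    unfolding vv by (rule member_le_sum) (use i assms(3) in auto)
  moreover have "(inner_upto n (u i) v)\<^sup>2 > 0" using coord[of i] i assms(3) by simp
  ultimately show "0 < inner_upto n v v" by linarith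
  have "e k * inner_upto n v v = (\<Sum>p<n. e k * (inner_upto n (u p) v)\<^sup>2)"
    by (simp add: vv sum_distrib_left)
  also have "\<dots> \<le> (\<Sum>p<n. e p * (inner_upto n (u p) v)\<^sup>2)"
  proof (rule sum_mono)
    fix p assume "p \<in> {..<n}"
    then show "e k * (inner_upto n (u p) v)\<^sup>2 \<le> e p * (inner_upto n (u p) v)\<^sup>2"
      using coord[of p] assms(2,3) unfolding eigenbasis_def
      by (cases "p \<le> k") (auto intro!: mult_right_mono)
  qed
  also have "\<dots> = quad_form n a v" by (rule quad_form_eigenbasis[OF assms(1,2), symmetric])
  finally show "e k * inner_upto n v v \<le> quad_form n a v" .
qed

lemma span_last_eigenvectors:
  assumes "symmetric_upto n a" "eigenbasis n a e u" "k < n"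
    and "\<exists>i\<in>{..k}. c i \<noteq> 0" "v = (\<lambda>t. \<Sum>i\<le>k. c i * u (n - 1 - i) t)"
  shows "0 < inner_upto n v v" "quad_form n a v \<le> e (n - 1 - k) * inner_upto n v v"
proof -
  have sym: "symmetric_upto n (\<lambda>i j. - a i j)" using assms(1) by (simp add: symmetric_upto_def)
  note * = span_first_eigenvectors[OF sym eigenbasis_uminus[OF assms(2)] assms(3,4,5)]
  show "0 < inner_upto n v v" by (fact *(1))
  show "quad_form n a v \<le> e (n - 1 - k) * inner_upto n v v" using *(2) by (simp add: quad_form_uminus)
qed

section \<open>Graph eigenvalues as entries of an eigenbasis\<close>

text \<open>
  The eigenvectors form the columns of a matrix that conjugates the given one to a diagonal matrix, and
  similar matrices have the same characteristic polynomial.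
\<close>

lemma proots_eigenbasis:
  assumes eb: "eigenbasis n a e u"
  shows "proots (char_poly (Matrix.mat n n (\<lambda>(i, j). a i j))) = mset (map e [0..<n])"
proof -
  let ?A = "Matrix.mat n n (\<lambda>(i, j). a i j)" and ?D = "Matrix.mat n n (\<lambda>(i, j). if i = j then e i else 0)"
  let ?U = "Matrix.mat n n (\<lambda>(i, p). u p i)" and ?V = "Matrix.mat n n (\<lambda>(p, i). u p i)"
  have VU: "?V * ?U = 1\<^sub>m n"
    using eb by (intro eq_matI) (auto simp: scalar_prod_def eigenbasis_def inner_upto_def lessThan_atLeast0)
  then have UV: "?U * ?V = 1\<^sub>m n" by (intro mat_mult_left_right_inverse[of ?V n ?U]) auto
  have AU: "?A * ?U = ?U * ?D"
  proof (rule eq_matI)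
    fix i p assume "i < dim_row (?U * ?D)" "p < dim_col (?U * ?D)"
    then have ip: "i < n" "p < n" by auto
    have "(?A * ?U) $$ (i, p) = mult_upto n a (u p) i"
      using ip by (simp add: scalar_prod_def mult_upto_def lessThan_atLeast0)
    also have "\<dots> = (\<Sum>r<n. if r = p then u p i * e p else 0)" using eb ip by (simp add: eigenbasis_def)
    also have "\<dots> = (\<Sum>r<n. u r i * (if r = p then e r else 0))" by (rule sum.cong) auto
    also have "\<dots> = (?U * ?D) $$ (i, p)"
      using ip by (simp add: scalar_prod_def lessThan_atLeast0)
    finally show "(?A * ?U) $$ (i, p) = (?U * ?D) $$ (i, p)" .
  qed auto
  have "?A = ?A * (?U * ?V)" by (simp add: UV)
  also have "\<dots> = ?A * ?U * ?V" by (rule assoc_mult_mat[symmetric]) auto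
  finally have "similar_mat_wit ?A ?D ?U ?V"
    unfolding similar_mat_wit_def Let_def using UV VU AU by auto
  then have "similar_mat ?A ?D" unfolding similar_mat_def by blast
  then have "char_poly ?A = char_poly ?D" by (rule char_poly_similar)
  also have "\<dots> = (\<Prod>a\<leftarrow>diag_mat ?D. [:- a, 1:])"
    by (rule char_poly_upper_triangular[of _ n]) auto
  also have "diag_mat ?D = map e [0..<n]" unfolding diag_mat_def by (auto intro: map_cong)
  finally have "char_poly ?A = prod_list (map (\<lambda>a. [:- a, 1:]) (map e [0..<n]))" .
  moreover have roots: "proots (prod_list (map (\<lambda>a. [:- a, 1:]) xs)) = mset xs" for xs :: "real list"
  proof (induction xs)
    case (Cons x xs)
    have "prod_list (map (\<lambda>a. [:- a, 1:]) xs) \<noteq> 0"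
      by (induction xs) (auto simp del: mult_pCons_left)
    then show ?case using Cons by (simp add: proots_mult proots_linear_factor del: mult_pCons_left)
  qed simp
  ultimately show ?thesis by (simp only:)
qed

definition adj :: "nat pair_pre_digraph \<Rightarrow> nat \<Rightarrow> nat \<Rightarrow> real" where
  "adj G i j = (if (i, j) \<in> parcs G then 1 else 0)"

lemma symmetric_adj:
  assumes "G \<in> graphs_of_order n"
  shows "symmetric_upto n (adj G)"
proof -
  interpret pair_graph G using assms by (simp add: graphs_of_order_def)
  have "(u, v) \<in> parcs G \<longleftrightarrow> (v, u) \<in> parcs G" for u v
    using pair_sym_arcs by (auto simp: symmetric_def sym_def)
  then show ?thesis by (auto simp: symmetric_upto_def adj_def)
qed

lemma graph_eigenvalue_eigenbasis:
  assumes "G \<in> graphs_of_order n" "eigenbasis n (adj G) e u" "p < n"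
  shows "graph_eigenvalue (Suc p) G = e p"
proof -
  have "pverts G = {..<n}" using assms(1) by (simp add: graphs_of_order_def)
  then have "adjacency_matrix G = Matrix.mat n n (\<lambda>(i, j). adj G i j)"
    by (simp add: adjacency_matrix_def adj_def)
  then have "proots (char_poly (adjacency_matrix G)) = mset (map e [0..<n])"
    using proots_eigenbasis[OF assms(2)] by simp
  then have "eigenvalues_decreasing G = rev (sort (map e [0..<n]))"
    unfolding eigenvalues_decreasing_def by (simp only: sorted_list_of_multiset_mset)
  also have "sort (map e [0..<n]) = rev (map e [0..<n])"
  proof (rule properties_for_sort)
    show "sorted (rev (map e [0..<n]))"
      using assms(2) by (auto simp: eigenbasis_def sorted_iff_nth_mono rev_nth)
  qed simp
  finally show ?thesis using assms(3) by (simp add: graph_eigenvalue_def)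
qed

lemma graph_eigenbasis:
  assumes "G \<in> graphs_of_order n"
  obtains e u where "eigenbasis n (adj G) e u"
  using ex_eigenbasis[OF symmetric_adj[OF assms]] that by blast

section \<open>Graphs of a given order\<close>

lemma graph_complement_in_graphs_of_order:
  assumes "G \<in> graphs_of_order n"
  shows "graph_complement G \<in> graphs_of_order n"
proof -
  interpret G: pair_graph G using assms by (simp add: graphs_of_order_def)
  have sym: "(u, v) \<in> parcs G \<longleftrightarrow> (v, u) \<in> parcs G" for u v
    using G.pair_sym_arcs by (auto simp: symmetric_def sym_def)
  have V: "pverts G = {..<n}" using assms by (simp add: graphs_of_order_def)
  have "finite (parcs (graph_complement G))"
    by (rule finite_subset[of _ "{..<n} \<times> {..<n}"]) (auto simp: graph_complement_def V)
  then have "pair_graph (graph_complement G)"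
    by unfold_locales (auto simp: graph_complement_def V symmetric_def sym_def sym)
  then show ?thesis by (simp add: graphs_of_order_def graph_complement_def V)
qed

lemma graphs_of_order_simple:
  assumes "finite E" "\<And>u v. (u, v) \<in> E \<Longrightarrow> u < n \<and> v < n \<and> u \<noteq> v \<and> (v, u) \<in> E"
  shows "\<lparr>pverts = {..<n}, parcs = E\<rparr> \<in> graphs_of_order n"
proof -
  have "pair_graph \<lparr>pverts = {..<n}, parcs = E\<rparr>"
    by unfold_locales (use assms in \<open>auto simp: symmetric_def sym_def\<close>)
  then show ?thesis by (simp add: graphs_of_order_def)
qed

lemma finite_graphs_of_order: "finite (graphs_of_order n)"
proof (rule finite_subset)
  show "graphs_of_order n \<subseteq> (\<lambda>E. \<lparr>pverts = {..<n}, parcs = E\<rparr>) ` Pow ({..<n} \<times> {..<n})"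
  proof
    fix G assume G: "G \<in> graphs_of_order n"
    then interpret G: pair_graph G by (simp add: graphs_of_order_def)
    have V: "pverts G = {..<n}" using G by (simp add: graphs_of_order_def)
    then have "G = \<lparr>pverts = {..<n}, parcs = parcs G\<rparr>" by simp
    moreover have "parcs G \<subseteq> {..<n} \<times> {..<n}"
      using G.in_arcsD1 G.in_arcsD2 V by auto
    ultimately show "G \<in> (\<lambda>E. \<lparr>pverts = {..<n}, parcs = E\<rparr>) ` Pow ({..<n} \<times> {..<n})" by blast
  qed
qed simp

lemma graphs_of_order_nonempty: "graphs_of_order n \<noteq> {}"
  using graphs_of_order_simple[of "{}" n] by auto

lemma adj_graph_complement:
  assumes "G \<in> graphs_of_order n" "i < n" "j < n"
  shows "adj (graph_complement G) i j = (if i = j then 0 else 1 - adj G i j)"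
  using assms by (auto simp: adj_def graph_complement_def graphs_of_order_def)

lemma adj_self:
  assumes "G \<in> graphs_of_order n"
  shows "adj G i i = 0"
proof -
  interpret G: pair_graph G using assms by (simp add: graphs_of_order_def)
  show ?thesis using G.no_loops'[of i i] by (auto simp: adj_def)
qed

section \<open>Blow-ups\<close>

lemma sum_div_mod:
  fixes f :: "nat \<Rightarrow> nat \<Rightarrow> real"
  shows "(\<Sum>v<t * n. f (v div n) (v mod n)) = (\<Sum>b<t. \<Sum>i<n. f b i)"
proof -
  have "(\<Sum>v<t * n. f (v div n) (v mod n)) = (\<Sum>b<t. \<Sum>v\<in>{b * n..<b * n + n}. f (v div n) (v mod n))"
    by (rule sum.nat_group[symmetric])
  also have "\<dots> = (\<Sum>b<t. \<Sum>i<n. f b i)"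
  proof (rule sum.cong)
    fix b
    have block: "v div n = b" "v mod n = v - b * n" if "b * n \<le> v" "v < b * n + n" for v
    proof -
      have "v = b * n + (v - b * n)" "v - b * n < n" using that by auto
      then show "v div n = b" "v mod n = v - b * n"
        by (metis div_less div_mult_self3 add.right_neutral gr_implies_not0, metis mod_less mod_mult_self3)
    qed
    show "(\<Sum>v\<in>{b * n..<b * n + n}. f (v div n) (v mod n)) = (\<Sum>i<n. f b i)"
      by (rule sum.reindex_bij_witness[of _ "\<lambda>i. b * n + i" "\<lambda>v. v - b * n"])
        (auto simp: block)
  qed simp
  finally show ?thesis .
qed

lemma quad_form_eq_sum:
  "quad_form n a x = (\<Sum>i<n. \<Sum>j<n. a i j * x i * x j)"
  by (simp add: quad_form_def inner_upto_def mult_upto_def sum_distrib_left mult_ac)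

text \<open>
  If \<open>n\<close> does not divide the order of the blow-up, the incomplete last group of vertices gets the value
  \<open>0\<close>. This treats blowing up and adding vertices at the same time.
\<close>

definition blowup_vec :: "nat \<Rightarrow> nat \<Rightarrow> (nat \<Rightarrow> real) \<Rightarrow> nat \<Rightarrow> real" where
  "blowup_vec n t x v = (if v < t * n then x (v mod n) else 0)"

lemma inner_upto_blowup_vec:
  assumes "t * n \<le> m"
  shows "inner_upto m (blowup_vec n t x) (blowup_vec n t y) = real t * inner_upto n x y"
proof -
  have "inner_upto m (blowup_vec n t x) (blowup_vec n t y) = (\<Sum>v<t * n. x (v mod n) * y (v mod n))"
    unfolding inner_upto_def by (rule sum.mono_neutral_cong_right) (use assms in \<open>auto simp: blowup_vec_def\<close>)
  also have "\<dots> = real t * inner_upto n x y"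
    using sum_div_mod[of "\<lambda>_ i. x i * y i" n t] by (simp add: inner_upto_def)
  finally show ?thesis .
qed

lemma quad_form_blowup_vec:
  assumes "t * n \<le> m"
  shows "quad_form m (\<lambda>u v. a (u mod n) (v mod n)) (blowup_vec n t x) = (real t)\<^sup>2 * quad_form n a x"
proof -
  have "quad_form m (\<lambda>u v. a (u mod n) (v mod n)) (blowup_vec n t x) =
      (\<Sum>u<t * n. \<Sum>v<m. a (u mod n) (v mod n) * blowup_vec n t x u * blowup_vec n t x v)"
    unfolding quad_form_eq_sum
    by (rule sum.mono_neutral_cong_right) (use assms in \<open>auto simp: blowup_vec_def\<close>)
  also have "\<dots> = (\<Sum>u<t * n. \<Sum>v<t * n. a (u mod n) (v mod n) * x (u mod n) * x (v mod n))"
    by (intro sum.cong sum.mono_neutral_cong_right) (use assms in \<open>auto simp: blowup_vec_def\<close>)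
  also have "\<dots> = (\<Sum>u<t * n. real t * (\<Sum>j<n. a (u mod n) j * x (u mod n) * x j))"
    using sum_div_mod[of "\<lambda>_ j. a i j * x i * x j" n t for i] by simp
  also have "\<dots> = real t * (real t * quad_form n a x)"
    using sum_div_mod[of "\<lambda>_ i. real t * (\<Sum>j<n. a i j * x i * x j)" n t]
    by (simp add: quad_form_eq_sum sum_distrib_left)
  finally show ?thesis by (simp add: power2_eq_square)
qed

lemma quad_form_diagonal: "quad_form n (\<lambda>i j. if i = j then c i else 0) x = (\<Sum>i<n. c i * (x i)\<^sup>2)"
proof -
  have "mult_upto n (\<lambda>i j. if i = j then c i else 0) x i = c i * x i" if "i < n" for i
    using that by (simp add: mult_upto_def if_distrib[of "\<lambda>t. t * _"] cong: if_cong)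
  then show ?thesis by (simp add: quad_form_def inner_upto_def power2_eq_square mult_ac)
qed

lemma quad_form_linear:
  "quad_form n (\<lambda>i j. a i j + s * b i j) x = quad_form n a x + s * quad_form n b x"
  by (simp add: quad_form_eq_sum sum.distrib sum_distrib_left algebra_simps)

lemma quad_form_cong_matrix:
  "(\<And>i j. i < n \<Longrightarrow> j < n \<Longrightarrow> a i j = b i j) \<Longrightarrow> quad_form n a x = quad_form n b x"
  by (simp add: quad_form_eq_sum)

lemma blowup_vec_sum:
  "blowup_vec n t (\<lambda>v. \<Sum>i\<in>I. c i * u i v) = (\<lambda>v. \<Sum>i\<in>I. c i * blowup_vec n t (u i) v)"
  by (auto simp: blowup_vec_def)

text \<open>
  In the blow-up of a graph, copies of the same vertex are not adjacent, so \<open>s = 0\<close>; in its complement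
  they are, so \<open>s = 1\<close>. In both cases the lifted vectors \<open>blowup_vec n t x\<close> have the Rayleigh quotient
  of \<open>x\<close> times \<open>t\<close> plus \<open>s (t - 1)\<close>, and lifting preserves dimensions.
\<close>

lemma eigenvalues_blowup:
  assumes n: "n \<le> m" "t = m div n" and p: "p < n"
    and a: "symmetric_upto n a" "eigenbasis n a e u"
    and b: "symmetric_upto m b" "eigenbasis m b e' u'"
    and rel: "\<And>i j. i < m \<Longrightarrow> j < m \<Longrightarrow>
      b i j = a (i mod n) (j mod n) + s * ((if i mod n = j mod n then 1 else 0) - (if i = j then 1 else 0))"
  shows "real t * e p + s * (real t - 1) \<le> e' p"
    and "e' (m - 1 - p) \<le> real t * e (n - 1 - p) + s * (real t - 1)"
proof -
  have t: "t * n \<le> m" "t > 0" using n p by (auto simp: div_greater_zero_iff)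
  have q: "quad_form m b (blowup_vec n t x) =
      real t * (real t * quad_form n a x + s * (real t - 1) * inner_upto n x x)"
    and N: "inner_upto m (blowup_vec n t x) (blowup_vec n t x) = real t * inner_upto n x x" for x
  proof -
    show N: "inner_upto m (blowup_vec n t x) (blowup_vec n t x) = real t * inner_upto n x x"
      by (rule inner_upto_blowup_vec[OF t(1)])
    let ?I = "\<lambda>i j::nat. if i = j then 1 else 0 :: real"
    have "quad_form m b (blowup_vec n t x) =
        quad_form m (\<lambda>i j. (a (i mod n) (j mod n) + s * ?I (i mod n) (j mod n)) + (- s) * ?I i j) (blowup_vec n t x)"
      by (rule quad_form_cong_matrix) (simp add: rel algebra_simps)
    also have "\<dots> = (real t)\<^sup>2 * quad_form n a x + s * ((real t)\<^sup>2 * quad_form n ?I x)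
        + (- s) * quad_form m ?I (blowup_vec n t x)"
      unfolding quad_form_linear using quad_form_blowup_vec[OF t(1), of a] quad_form_blowup_vec[OF t(1), of ?I] by simp
    also have "quad_form n ?I x = inner_upto n x x"
      by (simp add: quad_form_diagonal inner_upto_def power2_eq_square)
    also have "quad_form m ?I (blowup_vec n t x) = inner_upto m (blowup_vec n t x) (blowup_vec n t x)"
      by (simp add: quad_form_diagonal inner_upto_def power2_eq_square)
    finally show "quad_form m b (blowup_vec n t x) =
      real t * (real t * quad_form n a x + s * (real t - 1) * inner_upto n x x)"
      by (simp add: N power2_eq_square algebra_simps)
  qed
  show "real t * e p + s * (real t - 1) \<le> e' p"
  proof (rule eigenvalue_ge_of_subspace[OF b, where I = "{..p}" and K = "{}" and w = "\<lambda>i. blowup_vec n t (u i)"])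
    fix c v assume c: "\<exists>i\<in>{..p}. c i \<noteq> 0" and v: "v = (\<lambda>k. \<Sum>i\<le>p. c i * blowup_vec n t (u i) k)"
    define x where "x = (\<lambda>k. \<Sum>i\<le>p. c i * u i k)"
    have v': "v = blowup_vec n t x" unfolding v x_def blowup_vec_sum ..
    from span_first_eigenvectors[OF a p c x_def]
    have "0 < inner_upto n x x" "e p * inner_upto n x x \<le> quad_form n a x" by auto
    then show "0 < inner_upto m v v \<and> (real t * e p + s * (real t - 1)) * inner_upto m v v \<le> quad_form m b v"
      unfolding v' N q using t(2)
      by (simp add: algebra_simps)
  qed (use n p in auto)
  show "e' (m - 1 - p) \<le> real t * e (n - 1 - p) + s * (real t - 1)"
  proof (rule eigenvalue_le_of_subspace[OF b, where I = "{..p}" and w = "\<lambda>i. blowup_vec n t (u (n - 1 - i))"])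
    fix c v assume c: "\<exists>i\<in>{..p}. c i \<noteq> 0" and v: "v = (\<lambda>k. \<Sum>i\<le>p. c i * blowup_vec n t (u (n - 1 - i)) k)"
    define x where "x = (\<lambda>k. \<Sum>i\<le>p. c i * u (n - 1 - i) k)"
    have v': "v = blowup_vec n t x" unfolding v x_def blowup_vec_sum ..
    from span_last_eigenvectors[OF a p c x_def]
    have "0 < inner_upto n x x" "quad_form n a x \<le> e (n - 1 - p) * inner_upto n x x" by auto
    then show "0 < inner_upto m v v \<and> quad_form m b v \<le> (real t * e (n - 1 - p) + s * (real t - 1)) * inner_upto m v v"
      unfolding v' N q using t(2)
      by (simp add: algebra_simps)
  qed (use n p in auto)
qed

definition graph_blowup :: "nat \<Rightarrow> nat \<Rightarrow> nat pair_pre_digraph \<Rightarrow> nat pair_pre_digraph" where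
  "graph_blowup m n G = \<lparr>pverts = {..<m}, parcs = {(u, v). u < m \<and> v < m \<and> (u mod n, v mod n) \<in> parcs G}\<rparr>"

lemma graph_blowup_in_graphs_of_order:
  assumes "G \<in> graphs_of_order n"
  shows "graph_blowup m n G \<in> graphs_of_order m"
  unfolding graph_blowup_def
proof (rule graphs_of_order_simple)
  interpret G: pair_graph G using assms by (simp add: graphs_of_order_def)
  have sym: "(u, v) \<in> parcs G \<longleftrightarrow> (v, u) \<in> parcs G" for u v
    using G.pair_sym_arcs by (auto simp: symmetric_def sym_def)
  show "finite {(u, v). u < m \<and> v < m \<and> (u mod n, v mod n) \<in> parcs G}"
    by (rule finite_subset[of _ "{..<m} \<times> {..<m}"]) auto
  fix u v assume "(u, v) \<in> {(u, v). u < m \<and> v < m \<and> (u mod n, v mod n) \<in> parcs G}"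
  then show "u < m \<and> v < m \<and> u \<noteq> v \<and> (v, u) \<in> {(u, v). u < m \<and> v < m \<and> (u mod n, v mod n) \<in> parcs G}"
    using sym G.no_loops' by auto
qed

text \<open>
  The term \<open>t - 1\<close> that the complement contributes helps for the large eigenvalues and is dropped there. For the
  small ones it is an error, of size at most \<open>1/n\<close> after division by the order \<open>m\<close>.
\<close>

lemma graph_eigenvalue_blowup:
  assumes G: "G \<in> graphs_of_order n" and n: "n \<le> m" and k: "1 \<le> k" "k \<le> n"
  defines "t \<equiv> m div n" and "H \<equiv> graph_blowup m n G"
  shows "real t * graph_eigenvalue k G \<le> graph_eigenvalue k H"
    and "real t * graph_eigenvalue k (graph_complement G) \<le> graph_eigenvalue k (graph_complement H)"
    and "graph_eigenvalue (m - k + 1) H \<le> real t * graph_eigenvalue (n - k + 1) G"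
    and "graph_eigenvalue (m - k + 1) (graph_complement H) \<le>
      real t * graph_eigenvalue (n - k + 1) (graph_complement G) + (real t - 1)"
proof -
  have H: "H \<in> graphs_of_order m" unfolding H_def by (rule graph_blowup_in_graphs_of_order[OF G])
  note G' = graph_complement_in_graphs_of_order[OF G] and H' = graph_complement_in_graphs_of_order[OF H]
  obtain e u where e: "eigenbasis n (adj G) e u" by (rule graph_eigenbasis[OF G])
  obtain e' u' where e': "eigenbasis n (adj (graph_complement G)) e' u'" by (rule graph_eigenbasis[OF G'])
  obtain f v where f: "eigenbasis m (adj H) f v" by (rule graph_eigenbasis[OF H])
  obtain f' v' where f': "eigenbasis m (adj (graph_complement H)) f' v'" by (rule graph_eigenbasis[OF H'])
  define p where "p = k - 1"
  have p: "p < n" "k = Suc p" "n - k + 1 = Suc (n - 1 - p)" "m - k + 1 = Suc (m - 1 - p)" "p < m"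
    "n - 1 - p < n" "m - 1 - p < m"
    using k n by (auto simp: p_def)
  have t: "real t \<ge> 1" using n k unfolding t_def by (simp add: Suc_leI div_greater_zero_iff)
  have adjH: "adj H i j = adj G (i mod n) (j mod n)" if "i < m" "j < m" for i j
    using that by (simp add: H_def graph_blowup_def adj_def)
  have mod: "i mod n < n" for i using p by simp
  have 1: "adj H i j = adj G (i mod n) (j mod n) + 0 * ((if i mod n = j mod n then 1 else 0) - (if i = j then 1 else 0))"
    if "i < m" "j < m" for i j using adjH[OF that] by simp
  have 2: "adj (graph_complement H) i j = adj (graph_complement G) (i mod n) (j mod n) +
      1 * ((if i mod n = j mod n then 1 else 0) - (if i = j then 1 else 0))"
    if "i < m" "j < m" for i j
    using adjH[OF that] adj_graph_complement[OF H that] adj_graph_complement[OF G mod mod, of i j] adj_self[OF G]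
    by auto
  note A = eigenvalues_blowup[OF n t_def[THEN meta_eq_to_obj_eq] p(1) symmetric_adj[OF G] e symmetric_adj[OF H] f 1]
  note B = eigenvalues_blowup[OF n t_def[THEN meta_eq_to_obj_eq] p(1) symmetric_adj[OF G'] e' symmetric_adj[OF H'] f' 2]
  note top = graph_eigenvalue_eigenbasis[OF _ _ p(1)] graph_eigenvalue_eigenbasis[OF _ _ p(5)]
    and bot = graph_eigenvalue_eigenbasis[OF _ _ p(6)] graph_eigenvalue_eigenbasis[OF _ _ p(7)]
  have A: "real t * e p \<le> f p" "f (m - 1 - p) \<le> real t * e (n - 1 - p)"
    using A by auto
  have B: "real t * e' p + (real t - 1) \<le> f' p" "f' (m - 1 - p) \<le> real t * e' (n - 1 - p) + (real t - 1)"
    using B by auto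
  have ev: "graph_eigenvalue k G = e p" "graph_eigenvalue k H = f p"
    "graph_eigenvalue k (graph_complement G) = e' p" "graph_eigenvalue k (graph_complement H) = f' p"
    unfolding p(2) by (simp_all only: top(1)[OF G e] top(2)[OF H f] top(1)[OF G' e'] top(2)[OF H' f'])
  have ev': "graph_eigenvalue (n - k + 1) G = e (n - 1 - p)" "graph_eigenvalue (m - k + 1) H = f (m - 1 - p)"
    "graph_eigenvalue (n - k + 1) (graph_complement G) = e' (n - 1 - p)"
    "graph_eigenvalue (m - k + 1) (graph_complement H) = f' (m - 1 - p)"
    unfolding p(3,4) by (simp_all only: bot(1)[OF G e] bot(2)[OF H f] bot(1)[OF G' e'] bot(2)[OF H' f'])
  show "real t * graph_eigenvalue k G \<le> graph_eigenvalue k H" using A(1) ev by simp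
  show "graph_eigenvalue (m - k + 1) H \<le> real t * graph_eigenvalue (n - k + 1) G"
    using A(2) unfolding ev' by simp
  show "real t * graph_eigenvalue k (graph_complement G) \<le> graph_eigenvalue k (graph_complement H)"
    using B(1) t unfolding ev by linarith
  show "graph_eigenvalue (m - k + 1) (graph_complement H) \<le>
      real t * graph_eigenvalue (n - k + 1) (graph_complement G) + (real t - 1)"
    using B(2) unfolding ev' by linarith
qed

section \<open>Upper bounds\<close>

text \<open>
  On vectors orthogonal to the all-ones vector the two quadratic forms differ by half the squared norm; the
  orthogonality costs one dimension, which shifts the index. On all vectors \<open>b\<close> exceeds \<open>a\<close> by at
  most half the squared norm, because the all-ones matrix is positive semidefinite.
\<close>

lemma eigenvalues_half_shift:
  assumes a: "symmetric_upto n a" "eigenbasis n a e u"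
    and b: "symmetric_upto n b" "eigenbasis n b \<mu> v"
    and rel: "\<And>i j. i < n \<Longrightarrow> j < n \<Longrightarrow> b i j = a i j - 1/2 + (if i = j then 1/2 else 0)"
    and p: "p < n"
  shows "p > 0 \<Longrightarrow> e p + 1/2 \<le> \<mu> (p - 1)"
    and "\<mu> (n - 1 - p) \<le> e (n - 1 - p) + 1/2"
proof -
  have q: "quad_form n b x = quad_form n a x - (inner_upto n (\<lambda>_. 1) x)\<^sup>2 / 2 + inner_upto n x x / 2" for x
  proof -
    have "quad_form n b x = quad_form n (\<lambda>i j. (a i j + (-1/2) * 1) + 1/2 * (if i = j then 1 else 0)) x"
      by (rule quad_form_cong_matrix) (simp add: rel)
    also have "\<dots> = quad_form n a x + (-1/2) * quad_form n (\<lambda>i j. 1) x + 1/2 * inner_upto n x x"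
      unfolding quad_form_linear by (simp add: quad_form_diagonal inner_upto_def power2_eq_square)
    also have "quad_form n (\<lambda>i j. 1) x = (inner_upto n (\<lambda>_. 1) x)\<^sup>2"
      by (simp add: quad_form_def mult_upto_def inner_upto_def power2_eq_square sum_distrib_right)
    finally show ?thesis by simp
  qed
  show "e p + 1/2 \<le> \<mu> (p - 1)" if "p > 0"
  proof (rule eigenvalue_ge_of_subspace[OF b, where I = "{..p}" and K = "{()}" and w = u and z = "\<lambda>_ _. 1"])
    fix c x assume c: "\<exists>i\<in>{..p}. c i \<noteq> 0" and x: "x = (\<lambda>k. \<Sum>i\<le>p. c i * u i k)"
      and "\<And>k. k \<in> {()} \<Longrightarrow> inner_upto n (\<lambda>_. 1) x = 0"
    then have "inner_upto n (\<lambda>_. 1) x = 0" by simp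
    with span_first_eigenvectors[OF a p c x]
    show "0 < inner_upto n x x \<and> (e p + 1/2) * inner_upto n x x \<le> quad_form n b x"
      unfolding q by (simp add: algebra_simps)
  qed (use p that in auto)
  show "\<mu> (n - 1 - p) \<le> e (n - 1 - p) + 1/2"
  proof (rule eigenvalue_le_of_subspace[OF b, where I = "{..p}" and w = "\<lambda>i. u (n - 1 - i)"])
    fix c x assume c: "\<exists>i\<in>{..p}. c i \<noteq> 0" and x: "x = (\<lambda>k. \<Sum>i\<le>p. c i * u (n - 1 - i) k)"
    have "(inner_upto n (\<lambda>_. 1) x)\<^sup>2 / 2 \<ge> 0" by simp
    with span_last_eigenvectors[OF a p c x]
    show "0 < inner_upto n x x \<and> quad_form n b x \<le> (e (n - 1 - p) + 1/2) * inner_upto n x x"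
      unfolding q ring_distribs by linarith
  qed (use p in auto)
qed

text \<open>
  Let \<open>X\<close> and \<open>Y\<close> be the positive parts of the two eigenvalues, with the sign reversed at the lower end. The \<open>j\<close>
  eigenvalues at each end contribute at least \<open>j (X\<^sup>2 + Y\<^sup>2)\<close> to the squared Frobenius norm,
  which is at most \<open>n\<^sup>2/4\<close>, and \<open>(X + Y)\<^sup>2 \<le> 2 (X\<^sup>2 + Y\<^sup>2)\<close>.
\<close>

lemma eigenvalue_gap_le:
  assumes b: "symmetric_upto n b" "eigenbasis n b \<mu> v"
    and small: "\<And>i j. i < n \<Longrightarrow> j < n \<Longrightarrow> \<bar>b i j\<bar> \<le> 1/2"
    and j: "j > 0" "2 * j \<le> n"
  shows "\<mu> (j - 1) - \<mu> (n - j) \<le> real n / sqrt (2 * real j)"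
proof -
  define X Y where "X = max (\<mu> (j - 1)) 0" and "Y = max (- \<mu> (n - j)) 0"
  have mono: "\<mu> r \<le> \<mu> p" if "p \<le> r" "r < n" for p r using b(2) that by (auto simp: eigenbasis_def)
  have X: "X\<^sup>2 \<le> (\<mu> p)\<^sup>2" if "p < j" for p
    using mono[of p "j - 1"] that j unfolding X_def by (auto simp: max_def intro!: power_mono)
  have Y: "Y\<^sup>2 \<le> (\<mu> p)\<^sup>2" if "n - j \<le> p" "p < n" for p
  proof -
    have "Y \<le> \<bar>\<mu> p\<bar>" "Y \<ge> 0" using mono[of "n - j" p] that unfolding Y_def by auto
    then have "Y\<^sup>2 \<le> \<bar>\<mu> p\<bar>\<^sup>2" by (intro power_mono)
    then show ?thesis by simp
  qed
  have "real j * X\<^sup>2 + real j * Y\<^sup>2 = (\<Sum>p<j. X\<^sup>2) + (\<Sum>p\<in>{n-j..<n}. Y\<^sup>2)" using j by simp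
  also have "\<dots> \<le> (\<Sum>p<j. (\<mu> p)\<^sup>2) + (\<Sum>p\<in>{n-j..<n}. (\<mu> p)\<^sup>2)"
    by (intro add_mono sum_mono) (auto intro: X Y)
  also have "\<dots> = (\<Sum>p\<in>{..<j} \<union> {n-j..<n}. (\<mu> p)\<^sup>2)"
    using j by (subst sum.union_disjoint) auto
  also have "\<dots> \<le> (\<Sum>p<n. (\<mu> p)\<^sup>2)" using j by (intro sum_mono2) auto
  also have "\<dots> = (\<Sum>i<n. \<Sum>k<n. (b i k)\<^sup>2)" by (rule sum_eigenvalues_squared[OF b])
  also have "\<dots> \<le> (\<Sum>i<n. \<Sum>k<n. 1/4)"
  proof (intro sum_mono)
    fix i k assume "i \<in> {..<n}" "k \<in> {..<n}"
    then have "\<bar>b i k\<bar>\<^sup>2 \<le> (1/2)\<^sup>2" by (intro power_mono small) auto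
    then show "(b i k)\<^sup>2 \<le> 1/4" by (simp add: power2_eq_square)
  qed
  also have "\<dots> = (real n)\<^sup>2 / 4" by (simp add: power2_eq_square)
  finally have "X\<^sup>2 + Y\<^sup>2 \<le> (real n)\<^sup>2 / (4 * real j)" using j by (simp add: field_simps)
  then have XY: "2 * (X\<^sup>2 + Y\<^sup>2) \<le> 2 * ((real n)\<^sup>2 / (4 * real j))" by (rule mult_left_mono) simp
  have "(X + Y)\<^sup>2 = 2 * (X\<^sup>2 + Y\<^sup>2) - (X - Y)\<^sup>2" by (simp add: power2_eq_square algebra_simps)
  also have "\<dots> \<le> 2 * (X\<^sup>2 + Y\<^sup>2)" by simp
  also note XY
  also have "2 * ((real n)\<^sup>2 / (4 * real j)) = (real n)\<^sup>2 / (2 * real j)" by simp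
  also have "\<dots> = (real n / sqrt (2 * real j))\<^sup>2" by (simp add: power_divide)
  finally have "X + Y \<le> real n / sqrt (2 * real j)" by (rule power2_le_imp_le) simp
  then show ?thesis unfolding X_def Y_def by linarith
qed

text \<open>
  The matrix \<open>b\<close> of the graph and the matrix \<open>-b\<close> of the complement have opposite spectra, so that the
  two eigenvalues to be added lie at the two ends of the spectrum of \<open>b\<close>.
\<close>

lemma graph_eigenvalue_sum_bounds:
  assumes G: "G \<in> graphs_of_order n" and j: "j > 0" "2 * j \<le> n"
  shows "graph_eigenvalue (Suc j) G + graph_eigenvalue (Suc j) (graph_complement G) \<le> real n / sqrt (2 * real j) - 1"
    and "- graph_eigenvalue (n - j + 1) G - graph_eigenvalue (n - j + 1) (graph_complement G)
      \<le> real n / sqrt (2 * real j) + 1"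
proof -
  note G' = graph_complement_in_graphs_of_order[OF G]
  obtain e u where e: "eigenbasis n (adj G) e u" by (rule graph_eigenbasis[OF G])
  obtain e' u' where e': "eigenbasis n (adj (graph_complement G)) e' u'" by (rule graph_eigenbasis[OF G'])
  define b where "b i k = adj G i k - 1/2 + (if i = k then 1/2 else 0)" for i k :: nat
  have b: "symmetric_upto n b" using symmetric_adj[OF G] by (auto simp: symmetric_upto_def b_def)
  then have b': "symmetric_upto n (\<lambda>i k. - b i k)" by (auto simp: symmetric_upto_def)
  obtain \<mu> v where \<mu>: "eigenbasis n b \<mu> v" using ex_eigenbasis[OF b] by blast
  have rel: "b i k = adj G i k - 1/2 + (if i = k then 1/2 else 0)" for i k by (rule b_def)
  have rel': "- b i k = adj (graph_complement G) i k - 1/2 + (if i = k then 1/2 else 0)"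
    if "i < n" "k < n" for i k
    using adj_graph_complement[OF G that] adj_self[OF G] by (simp add: b_def)
  have gap: "\<mu> (j - 1) - \<mu> (n - j) \<le> real n / sqrt (2 * real j)"
    by (rule eigenvalue_gap_le[OF b \<mu> _ j]) (auto simp: b_def adj_self[OF G], auto simp: adj_def)
  note A = eigenvalues_half_shift[OF symmetric_adj[OF G] e b \<mu> rel]
  note B = eigenvalues_half_shift[OF symmetric_adj[OF G'] e' b' eigenbasis_uminus[OF \<mu>] rel']
  have i: "n - 1 - (j - 1) = n - j" "n - 1 - (n - j) = j - 1" using j by auto
  have "e j + e' j \<le> real n / sqrt (2 * real j) - 1"
    using A(1)[of j] B(1)[of j] gap j i by simp
  then show "graph_eigenvalue (Suc j) G + graph_eigenvalue (Suc j) (graph_complement G) \<le> real n / sqrt (2 * real j) - 1"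
    using graph_eigenvalue_eigenbasis[OF G e, of j] graph_eigenvalue_eigenbasis[OF G' e', of j] j by simp
  have "- e (n - j) - e' (n - j) \<le> real n / sqrt (2 * real j) + 1"
    using A(2)[of "j - 1", unfolded i] B(2)[of "j - 1", unfolded i] gap j by linarith
  then show "- graph_eigenvalue (n - j + 1) G - graph_eigenvalue (n - j + 1) (graph_complement G)
      \<le> real n / sqrt (2 * real j) + 1"
    using graph_eigenvalue_eigenbasis[OF G e, of "n - j"] graph_eigenvalue_eigenbasis[OF G' e', of "n - j"] j by simp
qed

text \<open>
  The squares of the \<open>j\<close> largest eigenvalues together are at most the squared Frobenius norm, hence at most \<open>n\<^sup>2\<close>. For eigenvalues counted from the bottom this shows that a positive one is \<open>o(n)\<close>, so
  that taking absolute values does not change the limit.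
\<close>

lemma graph_eigenvalue_le_sqrt:
  assumes G: "G \<in> graphs_of_order n" and j: "j > 0" "j \<le> n"
  shows "graph_eigenvalue j G \<le> real n / sqrt (real j)"
proof -
  obtain e u where e: "eigenbasis n (adj G) e u" by (rule graph_eigenbasis[OF G])
  define X where "X = max (e (j - 1)) 0"
  have "real j * X\<^sup>2 = (\<Sum>p<j. X\<^sup>2)" by simp
  also have "\<dots> \<le> (\<Sum>p<j. (e p)\<^sup>2)"
  proof (rule sum_mono)
    fix p assume "p \<in> {..<j}"
    then have "e (j - 1) \<le> e p" using e j by (auto simp: eigenbasis_def)
    then show "X\<^sup>2 \<le> (e p)\<^sup>2" unfolding X_def by (auto simp: max_def intro!: power_mono)
  qed
  also have "\<dots> \<le> (\<Sum>p<n. (e p)\<^sup>2)" using j by (intro sum_mono2) auto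
  also have "\<dots> = (\<Sum>i<n. \<Sum>k<n. (adj G i k)\<^sup>2)" by (rule sum_eigenvalues_squared[OF symmetric_adj[OF G] e])
  also have "\<dots> \<le> (\<Sum>i<n. \<Sum>k<n. 1)" by (intro sum_mono) (auto simp: adj_def)
  also have "\<dots> = (real n)\<^sup>2" by (simp add: power2_eq_square)
  finally have "X\<^sup>2 \<le> (real n / sqrt (real j))\<^sup>2" using j by (simp add: field_simps)
  then have "X \<le> real n / sqrt (real j)" by (rule power2_le_imp_le) simp
  moreover have "graph_eigenvalue j G = e (j - 1)"
    using graph_eigenvalue_eigenbasis[OF G e, of "j - 1"] j by simp
  ultimately show ?thesis by (simp add: X_def)
qed

section \<open>Kharaghani matrices\<close>

text \<open>
  These are the Rademacher functions, the signs of the \<open>s\<close> binary digits of \<open>x\<close>. Each induction step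
  doubles the range and adds the leading digit.
\<close>

lemma ex_orthogonal_signs:
  "\<exists>h :: nat \<Rightarrow> nat \<Rightarrow> real.
     (\<forall>c x. h c x = 1 \<or> h c x = -1) \<and>
     (\<forall>c<s. (\<Sum>x<2 ^ s. h c x) = 0) \<and>
     (\<forall>c<s. \<forall>d<s. c \<noteq> d \<longrightarrow> (\<Sum>x<2 ^ s. h c x * h d x) = 0)"
proof (induction s)
  case 0
  show ?case by (intro exI[of _ "\<lambda>_ _. 1"]) simp
next
  case (Suc s)
  then obtain h :: "nat \<Rightarrow> nat \<Rightarrow> real" where h: "\<And>c x. h c x = 1 \<or> h c x = -1"
    "\<And>c. c < s \<Longrightarrow> (\<Sum>x<2 ^ s. h c x) = 0"
    "\<And>c d. c < s \<Longrightarrow> d < s \<Longrightarrow> c \<noteq> d \<Longrightarrow> (\<Sum>x<2 ^ s. h c x * h d x) = 0"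
    by blast
  define g where "g c x = (if c < s then h c (x mod 2 ^ s) else if x div 2 ^ s = 0 then 1 else -1)" for c x
  have two: "(\<Sum>b<2. f b) = f 0 + f 1" for f :: "nat \<Rightarrow> real"
    by (simp add: numeral_2_eq_2)
  have halves: "(\<Sum>x<2 ^ Suc s. f (x div 2 ^ s) (x mod 2 ^ s)) = (\<Sum>x<2 ^ s. f 0 x + f 1 x)"
    for f :: "nat \<Rightarrow> nat \<Rightarrow> real"
    using sum_div_mod[of f "2 ^ s" 2] by (simp add: two sum.distrib)
  let ?F = "\<lambda>c b x. if c < s then h c x else if b = 0 then 1 else -1"
  have "(\<Sum>x<2 ^ Suc s. g c x) = 0" for c
    unfolding g_def halves[of "?F c"] using h(2)[of c] by (cases "c < s") (simp_all add: sum_distrib_left[symmetric])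
  moreover have "(\<Sum>x<2 ^ Suc s. g c x * g d x) = 0" if "c < Suc s" "d < Suc s" "c \<noteq> d" for c d
    unfolding g_def halves[of "\<lambda>b x. ?F c b x * ?F d b x"]
    using that h(2)[of c] h(2)[of d] h(3)[of c d]
    by (cases "c < s"; cases "d < s") (simp_all add: sum_distrib_left[symmetric])
  moreover have "\<forall>c x. g c x = 1 \<or> g c x = -1" using h(1) by (auto simp: g_def)
  ultimately show ?case by blast
qed

text \<open>
  Vertices are triples consisting of a half (\<open>0\<close> or \<open>1\<close>), a block below \<open>q\<close> and a cell below \<open>N\<close>, encoded in
  mixed radix. The matrix \<open>S\<close> is the tensor product of the \<open>2 \<times> 2\<close> Hadamard matrix on the halves with
  the Latin square arrangement of the matrices \<open>h\<^sub>c h\<^sub>c\<^sup>T\<close> on blocks and cells.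
\<close>

locale latin_sign_matrix =
  fixes q N :: nat and h :: "nat \<Rightarrow> nat \<Rightarrow> real"
  assumes q_pos: "q > 0" and N_pos: "N > 0"
    and h_sign: "\<And>c x. h c x = 1 \<or> h c x = -1"
    and h_sum: "\<And>c. c < q \<Longrightarrow> (\<Sum>x<N. h c x) = 0"
    and h_orth: "\<And>c d. c < q \<Longrightarrow> d < q \<Longrightarrow> c \<noteq> d \<Longrightarrow> (\<Sum>x<N. h c x * h d x) = 0"
begin

definition vertices where "vertices = 2 * q * N"

definition half :: "nat \<Rightarrow> nat" where "half v = v div N div q"
definition block :: "nat \<Rightarrow> nat" where "block v = v div N mod q"
definition cell :: "nat \<Rightarrow> nat" where "cell v = v mod N"

text \<open>
  The Latin square is the addition table modulo \<open>q\<close>, and \<open>partner c i\<close> is the column in which row \<open>i\<close>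
  has the symbol \<open>c\<close>.
\<close>

definition latin :: "nat \<Rightarrow> nat \<Rightarrow> nat" where "latin i j = (i + j) mod q"
definition partner :: "nat \<Rightarrow> nat \<Rightarrow> nat" where "partner c i = (c + q - i) mod q"

definition S :: "nat \<Rightarrow> nat \<Rightarrow> real" where
  "S v w = (if half v = 1 \<and> half w = 1 then -1 else 1) *
     (h (latin (block v) (block w)) (cell v) * h (latin (block v) (block w)) (cell w))"

text \<open>
  Let \<open>x\<close> be the vector that equals \<open>h c\<close> on block \<open>i\<close> of half \<open>0\<close> and vanishes elsewhere. On
  the space spanned by such vectors, together with their counterparts on half \<open>1\<close>, the square of \<open>S\<close> is
  \<open>\<theta>\<^sup>2\<close> for \<open>\<theta> = sqrt 2 * N\<close>. Hence \<open>\<theta> x + \<sigma> S x\<close> is an eigenvector of \<open>S\<close> for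
  \<open>\<sigma> \<theta>\<close>. It is this vector divided by \<open>N\<close>.
\<close>

definition eigvec :: "real \<Rightarrow> nat \<times> nat \<Rightarrow> nat \<Rightarrow> real" where
  "eigvec \<sigma> ic v = h (snd ic) (cell v) *
     (sqrt 2 * (if half v = 0 \<and> block v = fst ic then 1 else 0) + \<sigma> * (if block v = partner (snd ic) (fst ic) then 1 else 0))"

lemma sum_order:
  fixes f :: "nat \<Rightarrow> nat \<Rightarrow> nat \<Rightarrow> real"
  shows "(\<Sum>v<vertices. f (half v) (block v) (cell v)) = (\<Sum>\<epsilon><2. \<Sum>i<q. \<Sum>x<N. f \<epsilon> i x)"
proof -
  have "(\<Sum>v<vertices. f (half v) (block v) (cell v)) = (\<Sum>b<2 * q. \<Sum>x<N. f (b div q) (b mod q) x)"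
    using sum_div_mod[of "\<lambda>b x. f (b div q) (b mod q) x" N "2 * q"]
    by (simp add: vertices_def half_def block_def cell_def)
  also have "\<dots> = (\<Sum>\<epsilon><2. \<Sum>i<q. \<Sum>x<N. f \<epsilon> i x)" by (rule sum_div_mod)
  finally show ?thesis .
qed

lemma coords: "v < vertices \<Longrightarrow> half v < 2" "block v < q"
  using q_pos N_pos by (auto simp: half_def block_def vertices_def less_mult_imp_div_less mult.assoc)

lemma h_square: "h c x * h c x = 1" using h_sign[of c x] by auto

lemma h_inner: "c < q \<Longrightarrow> d < q \<Longrightarrow> (\<Sum>x<N. h c x * h d x) = (if c = d then real N else 0)"
  using h_orth[of c d] by (auto simp: h_square)

lemma latin_less: "latin i j < q" using q_pos by (simp add: latin_def)
lemma partner_less: "partner c i < q" using q_pos by (simp add: partner_def)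
lemma latin_commute: "latin i j = latin j i" by (simp add: latin_def add.commute)

text \<open>
  Rows and columns determine each other, and the square is symmetric, so \<open>partner c\<close> is an involution.
\<close>

lemma latin_eq_iff: "i < q \<Longrightarrow> j < q \<Longrightarrow> c < q \<Longrightarrow> latin i j = c \<longleftrightarrow> j = partner c i"
  unfolding latin_def partner_def
  by (cases "i + j < q"; cases "c < i") (auto simp: mod_if)

lemma partner_partner: "i < q \<Longrightarrow> c < q \<Longrightarrow> partner c (partner c i) = i"
  by (metis latin_commute latin_eq_iff partner_less)

lemma symmetric_S: "S v w = S w v"
  by (simp add: S_def latin_commute[of "block v"] mult_ac conj_commute)

lemma S_sign: "S v w = 1 \<or> S v w = -1"
  using h_sign[of "latin (block v) (block w)" "cell v"] h_sign[of "latin (block v) (block w)" "cell w"]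
  by (auto simp: S_def)

lemma S_row_sum: "(\<Sum>w<vertices. S v w) = 0"
proof -
  have "(\<Sum>w<vertices. S v w) = (\<Sum>\<delta><2::nat. \<Sum>j<q. \<Sum>y<N. (if half v = 1 \<and> \<delta> = 1 then -1 else 1) *
     (h (latin (block v) j) (cell v) * h (latin (block v) j) y))"
    unfolding S_def by (rule sum_order)
  also have "\<dots> = 0" by (simp add: sum_distrib_left[symmetric] h_sum latin_less)
  finally show ?thesis .
qed

lemma eigvec_sum: "c < q \<Longrightarrow> (\<Sum>v<vertices. eigvec \<sigma> (i, c) v) = 0"
proof -
  assume c: "c < q"
  have "(\<Sum>v<vertices. eigvec \<sigma> (i, c) v) = (\<Sum>\<delta><2::nat. \<Sum>j<q. \<Sum>y<N. h c y *
     (sqrt 2 * (if \<delta> = 0 \<and> j = i then 1 else 0) + \<sigma> * (if j = partner c i then 1 else 0)))"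
    unfolding eigvec_def fst_conv snd_conv by (rule sum_order)
  also have "\<dots> = 0" by (simp add: sum_distrib_right[symmetric] h_sum c)
  finally show ?thesis .
qed

text \<open>
  By orthogonality of the \<open>h c\<close>, only the blocks with symbol \<open>c\<close> act on a vector built from \<open>h c\<close>, and
  they move block \<open>j\<close> to block \<open>partner c j\<close> with a factor \<open>N\<close>. What remains is a computation with the
  \<open>2 \<times> 2\<close> Hadamard matrix.
\<close>

lemma S_eigvec:
  assumes v: "v < vertices" and ic: "i < q" "c < q" and \<sigma>: "\<sigma> = 1 \<or> \<sigma> = -1"
  shows "(\<Sum>w<vertices. S v w * eigvec \<sigma> (i, c) w) = \<sigma> * (sqrt 2 * real N) * eigvec \<sigma> (i, c) v"
proof -
  define \<kappa> where "\<kappa> \<delta> = (if half v = 1 \<and> \<delta> = 1 then -1 else 1 :: real)" for \<delta> :: nat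
  define g where "g \<delta> j = sqrt 2 * (if \<delta> = 0 \<and> j = i then 1 else 0) + \<sigma> * (if j = partner c i then 1 else 0)"
    for \<delta> j :: nat
  let ?i = "block v" and ?x = "cell v"
  have bi: "?i < q" by (rule coords)
  have "(\<Sum>w<vertices. S v w * eigvec \<sigma> (i, c) w) = (\<Sum>\<delta><2. \<Sum>j<q. \<Sum>y<N.
      \<kappa> \<delta> * (h (latin ?i j) ?x * h (latin ?i j) y) * (h c y * g \<delta> j))"
    unfolding S_def eigvec_def g_def \<kappa>_def fst_conv snd_conv by (rule sum_order)
  also have "\<dots> = (\<Sum>\<delta><2. \<Sum>j<q. \<kappa> \<delta> * h (latin ?i j) ?x * g \<delta> j * (\<Sum>y<N. h (latin ?i j) y * h c y))"
    by (simp add: sum_distrib_left mult_ac)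
  also have "\<dots> = (\<Sum>\<delta><2. \<Sum>j<q. if j = partner c ?i then \<kappa> \<delta> * h c ?x * g \<delta> j * real N else 0)"
  proof (intro sum.cong refl)
    fix \<delta> j assume "j \<in> {..<q}"
    then show "\<kappa> \<delta> * h (latin ?i j) ?x * g \<delta> j * (\<Sum>y<N. h (latin ?i j) y * h c y)
        = (if j = partner c ?i then \<kappa> \<delta> * h c ?x * g \<delta> j * real N else 0)"
      using latin_eq_iff[OF bi _ ic(2), of j] by (auto simp: h_inner latin_less ic)
  qed
  also have "\<dots> = (\<Sum>\<delta><2. \<kappa> \<delta> * h c ?x * g \<delta> (partner c ?i) * real N)"
    by (simp add: partner_less)
  also have "\<dots> = h c ?x * real N * (\<kappa> 0 * g 0 (partner c ?i) + \<kappa> 1 * g 1 (partner c ?i))"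
    by (simp add: numeral_2_eq_2 algebra_simps)
  also have "\<kappa> 0 * g 0 (partner c ?i) + \<kappa> 1 * g 1 (partner c ?i) = \<sigma> * sqrt 2 * g (half v) ?i"
  proof -
    have 1: "partner c ?i = partner c i \<longleftrightarrow> ?i = i" using partner_partner bi ic by metis
    have 2: "partner c ?i = i \<longleftrightarrow> ?i = partner c i" using partner_partner bi ic by metis
    have "half v = 0 \<or> half v = 1" using coords(1)[OF v] by auto
    then show ?thesis using \<sigma> by (auto simp: \<kappa>_def g_def 1 2 algebra_simps)
  qed
  finally show ?thesis by (simp add: eigvec_def g_def)
qed

text \<open>
  The vector for \<open>(i, c)\<close> is the only one with a component along \<open>h c\<close> in block \<open>partner c i\<close> of half
  \<open>1\<close>; the constant \<open>b\<close> has none there, since \<open>h c\<close> has sum \<open>0\<close>.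
\<close>

lemma eigvec_independent:
  assumes \<sigma>: "\<sigma> = 1 \<or> \<sigma> = -1"
    and zero: "\<And>v. v < vertices \<Longrightarrow> b + (\<Sum>ic\<in>{..<q} \<times> {..<q}. a ic * eigvec \<sigma> ic v) = 0"
    and ic: "i < q" "c < q"
  shows "a (i, c) = 0"
proof -
  let ?P = "{..<q} \<times> {..<q}"
  let ?j = "partner c i"
  \<comment> \<open>The vertices of block \<open>partner c i\<close> in half \<open>1\<close>, enumerated by cell.\<close>
  define V where "V x = (q + ?j) * N + x" for x
  have V: "half (V x) = 1" "block (V x) = ?j" "cell (V x) = x" "V x < vertices" if "x < N" for x
  proof -
    have b: "V x div N = q + ?j" "V x mod N = x" using that by (auto simp: V_def)
    show "half (V x) = 1" "block (V x) = ?j" "cell (V x) = x"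
      using partner_less[of c i] q_pos by (auto simp: half_def block_def cell_def b)
    have "(q + ?j) * N + x < (q + ?j) * N + N" using that by simp
    also have "\<dots> = (q + ?j + 1) * N" by simp
    also have "\<dots> \<le> (2 * q) * N" using partner_less[of c i] by (intro mult_right_mono) auto
    finally show "V x < vertices" by (simp add: V_def vertices_def)
  qed
  have "0 = (\<Sum>x<N. h c x * (b + (\<Sum>ic\<in>?P. a ic * eigvec \<sigma> ic (V x))))"
    using zero V by simp
  also have "\<dots> = b * (\<Sum>x<N. h c x) + (\<Sum>x<N. \<Sum>ic\<in>?P. a ic * (h c x * eigvec \<sigma> ic (V x)))"
    by (simp add: ring_distribs sum.distrib sum_distrib_left mult_ac)
  also have "(\<Sum>x<N. \<Sum>ic\<in>?P. a ic * (h c x * eigvec \<sigma> ic (V x))) =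
      (\<Sum>ic\<in>?P. \<Sum>x<N. a ic * (h c x * eigvec \<sigma> ic (V x)))" by (rule sum.swap)
  also have "\<dots> = (\<Sum>ic\<in>?P. if ic = (i, c) then a ic * (\<sigma> * real N) else 0)"
  proof (rule sum.cong)
    fix ic assume "ic \<in> ?P"
    then obtain i' c' where ic': "ic = (i', c')" "i' < q" "c' < q" by auto
    have "(\<Sum>x<N. a ic * (h c x * eigvec \<sigma> ic (V x))) =
        (\<Sum>x<N. a ic * (\<sigma> * (if ?j = partner c' i' then 1 else 0)) * (h c x * h c' x))"
      by (rule sum.cong) (auto simp: eigvec_def V ic')
    also have "\<dots> = a ic * (\<sigma> * (if ?j = partner c' i' then 1 else 0)) * (if c = c' then real N else 0)"
      unfolding sum_distrib_left[symmetric] using ic ic' by (simp add: h_inner)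
    also have "\<dots> = (if ic = (i, c) then a ic * (\<sigma> * real N) else 0)"
      using partner_partner ic ic' by (auto simp: mult.assoc) (metis)+
    finally show "(\<Sum>x<N. a ic * (h c x * eigvec \<sigma> ic (V x))) = (if ic = (i, c) then a ic * (\<sigma> * real N) else 0)" .
  qed simp
  also have "\<dots> = a (i, c) * (\<sigma> * real N)" using ic by simp
  finally have "a (i, c) * (\<sigma> * real N) = 0" using h_sum[OF ic(2)] by simp
  then show ?thesis using \<sigma> N_pos by auto
qed

text \<open>
  \<open>Q\<close> is the squared norm of the part of \<open>y\<close> in the eigenspace; the constant part \<open>b\<close> is orthogonal to it
  and in the kernel of \<open>S\<close>.
\<close>

lemma eigenspace:
  assumes \<sigma>: "\<sigma> = 1 \<or> \<sigma> = -1"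
    and y: "y = (\<lambda>v. b + (\<Sum>ic\<in>{..<q} \<times> {..<q}. a ic * eigvec \<sigma> ic v))"
  obtains Q where
    "Q \<ge> 0"
    "inner_upto vertices y y = b\<^sup>2 * real vertices + Q"
    "inner_upto vertices (\<lambda>_. 1) y = b * real vertices"
    "quad_form vertices S y = \<sigma> * (sqrt 2 * real N) * Q"
proof -
  let ?P = "{..<q} \<times> {..<q}"
  define x where "x = (\<lambda>v. \<Sum>ic\<in>?P. a ic * eigvec \<sigma> ic v)"
  have y': "y = (\<lambda>v. x v + b * 1)" by (simp add: y x_def add.commute)
  have one: "inner_upto vertices (\<lambda>_. 1) (\<lambda>_. 1) = real vertices" by (simp add: inner_upto_def)
  have "inner_upto vertices (\<lambda>_. 1) x = (\<Sum>ic\<in>?P. a ic * inner_upto vertices (\<lambda>_. 1) (eigvec \<sigma> ic))"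
    unfolding x_def by (rule inner_upto_sum_right)
  also have "\<dots> = 0" by (rule sum.neutral) (auto simp: inner_upto_def eigvec_sum)
  finally have ox: "inner_upto vertices (\<lambda>_. 1) x = 0" "inner_upto vertices x (\<lambda>_. 1) = 0"
    by (simp_all add: inner_upto_commute)
  have S1: "mult_upto vertices S (\<lambda>_. 1) v = 0" for v by (simp add: mult_upto_def S_row_sum)
  have Sx: "mult_upto vertices S x v = \<sigma> * (sqrt 2 * real N) * x v" if "v < vertices" for v
  proof -
    have "mult_upto vertices S x v = (\<Sum>w<vertices. \<Sum>ic\<in>?P. a ic * (S v w * eigvec \<sigma> ic w))"
      by (simp add: mult_upto_def x_def sum_distrib_left mult_ac)
    also have "\<dots> = (\<Sum>ic\<in>?P. \<Sum>w<vertices. a ic * (S v w * eigvec \<sigma> ic w))" by (rule sum.swap)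
    also have "\<dots> = (\<Sum>ic\<in>?P. a ic * (\<sigma> * (sqrt 2 * real N) * eigvec \<sigma> ic v))"
      unfolding sum_distrib_left[symmetric] by (intro sum.cong) (auto simp: S_eigvec[OF that _ _ \<sigma>])
    finally show ?thesis by (simp add: x_def sum_distrib_left mult_ac)
  qed
  have sym: "symmetric_upto vertices S" by (simp add: symmetric_upto_def symmetric_S)
  have "quad_form vertices S y = quad_form vertices S x + 2 * b * inner_upto vertices (mult_upto vertices S x) (\<lambda>_. 1)
      + b\<^sup>2 * quad_form vertices S (\<lambda>_. 1)"
    unfolding y' by (rule quad_form_add[OF sym])
  also have "inner_upto vertices (mult_upto vertices S x) (\<lambda>_. 1) = inner_upto vertices x (mult_upto vertices S (\<lambda>_. 1))"
    by (rule inner_mult_symmetric[OF sym, symmetric])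
  also have "\<dots> = 0" by (simp add: inner_upto_def S1)
  also have "quad_form vertices S (\<lambda>_. 1) = 0" by (simp add: quad_form_def inner_upto_def S1)
  also have "quad_form vertices S x = inner_upto vertices (\<lambda>v. 1 * x v) (\<lambda>v. \<sigma> * (sqrt 2 * real N) * x v)"
    unfolding quad_form_def by (rule inner_upto_cong) (auto simp: Sx)
  also have "\<dots> = \<sigma> * (sqrt 2 * real N) * inner_upto vertices x x" by (subst inner_upto_scale) simp
  finally have "quad_form vertices S y = \<sigma> * (sqrt 2 * real N) * inner_upto vertices x x" by simp
  moreover have "inner_upto vertices y y = b\<^sup>2 * real vertices + inner_upto vertices x x"
    unfolding y' inner_upto_add_left inner_upto_add_right by (simp add: ox one power2_eq_square)
  moreover have "inner_upto vertices (\<lambda>_. 1) y = b * real vertices"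
    unfolding y' inner_upto_add_right by (simp add: ox one)
  ultimately show thesis using that inner_upto_nonneg by blast
qed

lemma sqrt2_N_le_order: "sqrt 2 * real N \<le> real vertices"
proof -
  have "sqrt 2 \<le> 2 * real q" using q_pos sqrt2_less_2 by (smt (verit) of_nat_1 of_nat_less_iff One_nat_def Suc_leI of_nat_le_iff)
  then have "sqrt 2 * real N \<le> 2 * real q * real N" by (rule mult_right_mono) simp
  then show ?thesis by (simp add: vertices_def)
qed

text \<open>
  Up to the diagonal correction \<open>d\<close>, which costs at most \<open>1\<close>, the matrix is \<open>(J + \<sigma> S)/2\<close>. It is at least
  \<open>\<theta>/2\<close> on the eigenspace of \<open>\<sigma> S\<close> for \<open>\<theta>\<close> enlarged by the all-ones vector, of dimension
  \<open>q\<^sup>2 + 1\<close>, and it equals \<open>-\<theta>/2\<close> on the eigenspace for \<open>-\<theta>\<close>, of dimension \<open>q\<^sup>2\<close>. The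
  diagonal correction is subtracted, so it does no harm in the second case.
\<close>

lemma eigenvalues_signed_graph:
  assumes \<sigma>: "\<sigma> = 1 \<or> \<sigma> = -1"
    and a: "symmetric_upto vertices a" "eigenbasis vertices a e u"
    and rel: "\<And>v w. v < vertices \<Longrightarrow> w < vertices \<Longrightarrow> a v w = (1 + \<sigma> * S v w) / 2 - (if v = w then d v else 0)"
    and d: "\<And>v. 0 \<le> d v \<and> d v \<le> 1"
  shows "p \<le> q\<^sup>2 \<Longrightarrow> p < vertices \<Longrightarrow> sqrt 2 * real N / 2 - 1 \<le> e p"
    and "p < q\<^sup>2 \<Longrightarrow> p < vertices \<Longrightarrow> e (vertices - 1 - p) \<le> - (sqrt 2 * real N / 2)"
proof -
  let ?P = "{..<q} \<times> {..<q}" and ?\<theta> = "sqrt 2 * real N"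
  have quad: "quad_form vertices a y = (inner_upto vertices (\<lambda>_. 1) y)\<^sup>2 / 2 + \<sigma> * quad_form vertices S y / 2 - D"
    and D: "0 \<le> D" "D \<le> inner_upto vertices y y"
    if D_def: "D = (\<Sum>v<vertices. d v * (y v)\<^sup>2)" for y D
  proof -
    have "quad_form vertices a y =
        quad_form vertices (\<lambda>v w. (1/2 * 1 + \<sigma> / 2 * S v w) + (-1) * (if v = w then d v else 0)) y"
      by (rule quad_form_cong_matrix) (simp add: rel add_divide_distrib)
    also have "\<dots> = quad_form vertices (\<lambda>v w. 1/2 * 1) y + \<sigma> / 2 * quad_form vertices S y
        + (-1) * D"
      unfolding quad_form_linear by (simp only: quad_form_diagonal D_def)
    also have "quad_form vertices (\<lambda>v w. 1/2 * 1) y = (inner_upto vertices (\<lambda>_. 1) y)\<^sup>2 / 2"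
      by (simp add: quad_form_def mult_upto_def inner_upto_def power2_eq_square
          sum_distrib_right[symmetric] sum_divide_distrib[symmetric])
    finally show "quad_form vertices a y = (inner_upto vertices (\<lambda>_. 1) y)\<^sup>2 / 2 + \<sigma> * quad_form vertices S y / 2 - D"
      by simp
    show "0 \<le> D" unfolding D_def using d by (intro sum_nonneg) auto
    have "D \<le> (\<Sum>v<vertices. 1 * (y v)\<^sup>2)" unfolding D_def using d by (intro sum_mono mult_right_mono) auto
    then show "D \<le> inner_upto vertices y y" by (simp add: inner_upto_def power2_eq_square)
  qed
  have order_pos: "vertices > 0" using q_pos N_pos by (simp add: vertices_def)
  have pos: "0 < inner_upto vertices y y"
    if "\<tau> = 1 \<or> \<tau> = -1" "y = (\<lambda>v. b + (\<Sum>ic\<in>?P. c ic * eigvec \<tau> ic v))" "b \<noteq> 0 \<or> (\<exists>ic\<in>?P. c ic \<noteq> 0)"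
    for \<tau> b c y
  proof (rule ccontr)
    assume "\<not> ?thesis"
    then have 0: "inner_upto vertices y y = 0" using inner_upto_nonneg[of vertices y] by linarith
    then have z: "y v = 0" if "v < vertices" for v using inner_upto_eq_0 that by blast
    have c0: "\<forall>ic\<in>?P. c ic = 0"
      using eigvec_independent[OF that(1), of b c] z that(2) by auto
    then have "(\<Sum>ic\<in>?P. c ic * eigvec \<tau> ic 0) = 0" by (intro sum.neutral) simp
    then have "y 0 = b" unfolding that(2) by simp
    then have "b = 0" using z[OF order_pos] by simp
    then show False using that(3) c0 by auto
  qed
  show "?\<theta> / 2 - 1 \<le> e p" if p: "p \<le> q\<^sup>2" "p < vertices"
  proof (rule eigenvalue_ge_of_subspace[OF a, where I = "insert None (Some ` ?P)" and K = "{}"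
        and w = "\<lambda>k v. case k of None \<Rightarrow> 1 | Some ic \<Rightarrow> eigvec \<sigma> ic v"])
    have "card (insert None (Some ` ?P)) = Suc (q\<^sup>2)"
      by (subst card_insert_disjoint) (auto simp: card_image power2_eq_square)
    then show "p + card {} < card (insert None (Some ` ?P))" using p by simp
    fix c :: "(nat \<times> nat) option \<Rightarrow> real" and y
    assume c: "\<exists>i\<in>insert None (Some ` ?P). c i \<noteq> 0"
      and y: "y = (\<lambda>t. \<Sum>i\<in>insert None (Some ` ?P). c i * (case i of None \<Rightarrow> 1 | Some ic \<Rightarrow> eigvec \<sigma> ic t))"
    have y': "y = (\<lambda>v. c None + (\<Sum>ic\<in>?P. c (Some ic) * eigvec \<sigma> ic v))"
      unfolding y by (subst sum.insert) (auto simp: sum.reindex)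
    obtain Q where Q: "Q \<ge> 0" "inner_upto vertices y y = (c None)\<^sup>2 * real vertices + Q"
      "inner_upto vertices (\<lambda>_. 1) y = c None * real vertices"
      "quad_form vertices S y = \<sigma> * ?\<theta> * Q"
      by (rule eigenspace[OF \<sigma> y'])
    have ss: "\<sigma> * (\<sigma> * z) = z" for z using \<sigma> by auto
    have "quad_form vertices a y \<ge> (c None * real vertices)\<^sup>2 / 2 + ?\<theta> * Q / 2 - inner_upto vertices y y"
      using quad[OF refl, of y] D[OF refl, of y] unfolding Q(3,4) by (simp add: mult.assoc ss)
    moreover have "?\<theta> * ((c None)\<^sup>2 * real vertices) \<le> real vertices * ((c None)\<^sup>2 * real vertices)"
      using sqrt2_N_le_order by (rule mult_right_mono) simp
    ultimately have "(?\<theta> / 2 - 1) * inner_upto vertices y y \<le> quad_form vertices a y"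
      unfolding Q(2) by (simp add: power2_eq_square algebra_simps)
    moreover have "0 < inner_upto vertices y y" by (rule pos[OF \<sigma> y']) (use c in auto)
    ultimately show "0 < inner_upto vertices y y \<and> (?\<theta> / 2 - 1) * inner_upto vertices y y \<le> quad_form vertices a y" by simp
  qed (use p in auto)
  show "e (vertices - 1 - p) \<le> - (?\<theta> / 2)" if p: "p < q\<^sup>2" "p < vertices"
  proof (rule eigenvalue_le_of_subspace[OF a, where I = ?P and w = "eigvec (- \<sigma>)"])
    fix c y assume c: "\<exists>i\<in>?P. c i \<noteq> 0" and y: "y = (\<lambda>t. \<Sum>i\<in>?P. c i * eigvec (- \<sigma>) i t)"
    have y': "y = (\<lambda>v. 0 + (\<Sum>ic\<in>?P. c ic * eigvec (- \<sigma>) ic v))" by (simp add: y)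
    have \<sigma>': "- \<sigma> = 1 \<or> - \<sigma> = -1" using \<sigma> by auto
    obtain Q where Q: "Q \<ge> 0" "inner_upto vertices y y = 0\<^sup>2 * real vertices + Q"
      "inner_upto vertices (\<lambda>_. 1) y = 0 * real vertices"
      "quad_form vertices S y = - \<sigma> * ?\<theta> * Q"
      by (rule eigenspace[OF \<sigma>' y'])
    have ss: "\<sigma> * (\<sigma> * z) = z" for z using \<sigma> by auto
    have "quad_form vertices a y \<le> - (?\<theta> / 2) * inner_upto vertices y y"
      using quad[OF refl, of y] D[OF refl, of y] unfolding Q(2,3,4) by (simp add: mult.assoc ss)
    moreover have "0 < inner_upto vertices y y" by (rule pos[OF \<sigma>' y']) (use c in auto)
    ultimately show "0 < inner_upto vertices y y \<and> quad_form vertices a y \<le> - (?\<theta> / 2) * inner_upto vertices y y" by simp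
  qed (use p in \<open>auto simp: power2_eq_square\<close>)
qed

definition sign_graph :: "nat pair_pre_digraph" where
  "sign_graph = \<lparr>pverts = {..<vertices}, parcs = {(v, w). v < vertices \<and> w < vertices \<and> v \<noteq> w \<and> S v w = 1}\<rparr>"

lemma sign_graph_in_graphs_of_order: "sign_graph \<in> graphs_of_order vertices"
  unfolding sign_graph_def
proof (rule graphs_of_order_simple)
  show "finite {(v, w). v < vertices \<and> w < vertices \<and> v \<noteq> w \<and> S v w = 1}"
    by (rule finite_subset[of _ "{..<vertices} \<times> {..<vertices}"]) auto
qed (auto simp: symmetric_S)

text \<open>
  The complement is the graph of the matrix \<open>-S\<close>, which explains the parameter \<open>\<sigma>\<close> in the previous lemma.
\<close>

lemma graph_eigenvalue_sign_graph:
  assumes "G = sign_graph \<or> G = graph_complement sign_graph"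
  shows "k \<le> q\<^sup>2 \<Longrightarrow> k < vertices \<Longrightarrow> sqrt 2 * real N / 2 - 1 \<le> graph_eigenvalue (Suc k) G"
    and "0 < k \<Longrightarrow> k \<le> q\<^sup>2 \<Longrightarrow> k \<le> vertices \<Longrightarrow> graph_eigenvalue (vertices - k + 1) G \<le> - (sqrt 2 * real N / 2)"
proof -
  define \<sigma> where "\<sigma> = (if G = sign_graph then 1 else -1 :: real)"
  have \<sigma>: "\<sigma> = 1 \<or> \<sigma> = -1" by (simp add: \<sigma>_def)
  have G: "G \<in> graphs_of_order vertices"
    using assms sign_graph_in_graphs_of_order graph_complement_in_graphs_of_order by auto
  obtain e u where e: "eigenbasis vertices (adj G) e u" by (rule graph_eigenbasis[OF G])
  define d where "d v = (1 + \<sigma> * S v v) / 2" for v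
  have sg: "adj sign_graph v w = (1 + S v w) / 2 - (if v = w then (1 + S v v) / 2 else 0)"
    if "v < vertices" "w < vertices" for v w
    using that S_sign[of v w] by (auto simp: adj_def sign_graph_def)
  have rel: "adj G v w = (1 + \<sigma> * S v w) / 2 - (if v = w then d v else 0)"
    if "v < vertices" "w < vertices" for v w
  proof (cases "G = sign_graph")
    case True
    then show ?thesis using sg[OF that] by (simp add: \<sigma>_def d_def)
  next
    case False
    then have "G = graph_complement sign_graph" using assms by simp
    then show ?thesis
      using False sg[OF that] adj_graph_complement[OF sign_graph_in_graphs_of_order that]
      by (auto simp: \<sigma>_def d_def field_simps)
  qed
  have d: "0 \<le> d v \<and> d v \<le> 1" for v using S_sign[of v v] \<sigma> by (auto simp: d_def)
  note * = eigenvalues_signed_graph[OF \<sigma> symmetric_adj[OF G] e rel d]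
  show "sqrt 2 * real N / 2 - 1 \<le> graph_eigenvalue (Suc k) G" if "k \<le> q\<^sup>2" "k < vertices"
    using *(1)[OF _ _ that] graph_eigenvalue_eigenbasis[OF G e that(2)] by simp
  show "graph_eigenvalue (vertices - k + 1) G \<le> - (sqrt 2 * real N / 2)" if "0 < k" "k \<le> q\<^sup>2" "k \<le> vertices"
  proof -
    have "vertices - 1 - (k - 1) = vertices - k" "k - 1 < q\<^sup>2" "k - 1 < vertices" using that by auto
    then show ?thesis
      using *(2)[of "k - 1"] graph_eigenvalue_eigenbasis[OF G e, of "vertices - k"] that by simp
  qed
qed

end

section \<open>Existence of the limits\<close>

text \<open>
  Fekete's argument: \<open>(F n - c) / n\<close> converges to its supremum over the admissible \<open>n\<close>, since
  \<open>(m div n) / m\<close> tends to \<open>1 / n\<close> and so the value at any \<open>n\<close> is asymptotically a lower bound for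
  the values at all \<open>m\<close>.
\<close>

lemma supermultiplicative_limit:
  fixes F :: "nat \<Rightarrow> real" and c C :: real
  assumes super: "\<And>n m. start \<le> n \<Longrightarrow> n \<le> m \<Longrightarrow> real (m div n) * (F n - c) \<le> F m"
    and bound: "\<And>n. start \<le> n \<Longrightarrow> F n \<le> C * real n + c"
    and start: "start > 0"
  obtains L where "(\<lambda>n. F n / real n) \<longlonglongrightarrow> L" "\<And>n. start \<le> n \<Longrightarrow> (F n - c) / real n \<le> L"
proof -
  define s where "s n = (F n - c) / real n" for n
  define L where "L = (SUP n\<in>{start..}. s n)"
  have "s n \<le> C" if "start \<le> n" for n
    using bound[OF that] that start unfolding s_def by (simp add: field_simps)
  then have bdd: "bdd_above (s ` {start..})" by (auto intro!: bdd_aboveI2)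
  have sL: "s n \<le> L" if "start \<le> n" for n
    unfolding L_def by (rule cSUP_upper[OF _ bdd]) (use that in auto)
  have "(\<lambda>n. s n) \<longlonglongrightarrow> L"
  proof (rule order_tendstoI)
    fix a assume "a < L"
    then obtain n where n: "start \<le> n" "a < s n"
      unfolding L_def by (subst (asm) less_cSUP_iff[OF _ bdd]) auto
    \<comment> \<open>The remainder \<open>m mod n\<close> is lost in the blow-up; bounding it by \<open>n\<close> gives an error \<open>O(1/m)\<close>, whatever the sign of \<open>s n\<close>.\<close>
    have lower: "s n - (\<bar>s n\<bar> * real n + \<bar>c\<bar>) * (1 / real m) \<le> s m" if "m \<ge> n" for m
    proof -
      have pos: "real n > 0" "real m > 0" using n start that by auto
      have Fn: "F n - c = s n * real n" using pos by (simp add: s_def)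
      have "m = n * (m div n) + m mod n" by simp
      then have m: "real m = real n * real (m div n) + real (m mod n)"
        by (metis of_nat_add of_nat_mult)
      have "s n * real (m mod n) \<le> \<bar>s n\<bar> * real n"
        using pos by (intro mult_mono) (auto intro: less_imp_le)
      moreover have "s n * real m - s n * real (m mod n) = real (m div n) * (F n - c)"
        unfolding m Fn by (simp add: algebra_simps)
      ultimately have "s n * real m - (\<bar>s n\<bar> * real n + \<bar>c\<bar>) \<le> F m - c"
        using super[OF n(1) that] by linarith
      then have "(s n * real m - (\<bar>s n\<bar> * real n + \<bar>c\<bar>)) / real m \<le> s m"
        unfolding s_def[of m] using pos by (intro divide_right_mono) auto
      then show ?thesis using pos by (simp add: diff_divide_distrib)
    qed
    have "(\<lambda>m. s n - (\<bar>s n\<bar> * real n + \<bar>c\<bar>) * (1 / real m)) \<longlonglongrightarrow> s n - (\<bar>s n\<bar> * real n + \<bar>c\<bar>) * 0"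
      by (intro tendsto_intros lim_1_over_n)
    then have "\<forall>\<^sub>F m in sequentially. a < s n - (\<bar>s n\<bar> * real n + \<bar>c\<bar>) * (1 / real m)"
      using n(2) by (intro order_tendstoD(1)) auto
    then show "\<forall>\<^sub>F m in sequentially. a < s m"
      using eventually_ge_at_top[of n] by eventually_elim (use lower in fastforce)
  next
    fix a assume "L < a"
    show "\<forall>\<^sub>F m in sequentially. s m < a"
      using eventually_ge_at_top[of start] by eventually_elim (use sL \<open>L < a\<close> in fastforce)
  qed
  moreover have "(\<lambda>n. c * (1 / real n)) \<longlonglongrightarrow> c * 0" by (intro tendsto_intros lim_1_over_n)
  ultimately have "(\<lambda>n. s n + c * (1 / real n)) \<longlonglongrightarrow> L + c * 0" by (rule tendsto_add)
  then have "(\<lambda>n. F n / real n) \<longlonglongrightarrow> L" by (simp add: s_def diff_divide_distrib)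
  then show thesis using that sL by (auto simp: s_def)
qed

lemma f_pos_n_ge:
  assumes "G \<in> graphs_of_order n"
  shows "graph_eigenvalue j G + graph_eigenvalue j (graph_complement G) \<le> f_pos_n j n"
  unfolding f_pos_n_def by (rule Max_ge) (use assms finite_graphs_of_order in auto)

lemma f_pos_n_attained:
  obtains G where "G \<in> graphs_of_order n"
    "f_pos_n j n = graph_eigenvalue j G + graph_eigenvalue j (graph_complement G)"
proof -
  have "f_pos_n j n \<in> (\<lambda>G. graph_eigenvalue j G + graph_eigenvalue j (graph_complement G)) ` graphs_of_order n"
    unfolding f_pos_n_def by (rule Max_in) (use finite_graphs_of_order graphs_of_order_nonempty in auto)
  then show thesis using that by blast
qed

lemma f_pos_properties:
  assumes k: "k \<ge> 2"
  shows "f_pos k \<le> 1 / sqrt (2 * (real k - 1))"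
    and "2 * k \<le> n \<Longrightarrow> f_pos_n k n / real n \<le> f_pos k"
proof -
  define j where "j = k - 1"
  have j: "j > 0" "k = Suc j" "real k - 1 = real j" using k by (auto simp: j_def)
  let ?C = "1 / sqrt (2 * real j)"
  have bound: "f_pos_n k n \<le> ?C * real n + 0" if "2 * k \<le> n" for n
  proof -
    obtain G where G: "G \<in> graphs_of_order n"
      "f_pos_n k n = graph_eigenvalue k G + graph_eigenvalue k (graph_complement G)"
      by (rule f_pos_n_attained)
    show ?thesis using graph_eigenvalue_sum_bounds(1)[OF G(1) j(1)] that G(2) unfolding j(2) by simp
  qed
  have super: "real (m div n) * (f_pos_n k n - 0) \<le> f_pos_n k m" if "2 * k \<le> n" "n \<le> m" for n m
  proof -
    obtain G where G: "G \<in> graphs_of_order n"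
      "f_pos_n k n = graph_eigenvalue k G + graph_eigenvalue k (graph_complement G)"
      by (rule f_pos_n_attained)
    have "1 \<le> k" "k \<le> n" using that k by auto
    from graph_eigenvalue_blowup(1,2)[OF G(1) that(2) this]
      f_pos_n_ge[OF graph_blowup_in_graphs_of_order[OF G(1), of m], of k]
    show ?thesis by (simp add: G(2) ring_distribs)
  qed
  obtain L where L: "(\<lambda>n. f_pos_n k n / real n) \<longlonglongrightarrow> L"
    "\<And>n. 2 * k \<le> n \<Longrightarrow> (f_pos_n k n - 0) / real n \<le> L"
    by (rule supermultiplicative_limit[where start = "2 * k", OF super bound]) (use k in auto)
  have "f_pos k = L" unfolding f_pos_def using L(1) by (rule limI)
  then show "2 * k \<le> n \<Longrightarrow> f_pos_n k n / real n \<le> f_pos k" using L(2) by simp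
  have "\<forall>\<^sub>F n in sequentially. f_pos_n k n / real n \<le> ?C"
    using eventually_ge_at_top[of "2 * k"]
  proof eventually_elim
    case (elim n)
    then have "real n > 0" using k by simp
    then show ?case using bound[OF elim] by (simp add: divide_le_eq)
  qed
  then show "f_pos k \<le> 1 / sqrt (2 * (real k - 1))"
    unfolding j(3) \<open>f_pos k = L\<close> by (intro tendsto_upperbound[OF L(1)]) auto
qed

text \<open>
  Without the absolute values the quantity behaves well under blowing up. It replaces the one with absolute
  values, from which it differs by \<open>o(n)\<close>.
\<close>

definition neg_sum :: "nat \<Rightarrow> nat \<Rightarrow> nat pair_pre_digraph \<Rightarrow> real" where
  "neg_sum j n G = - graph_eigenvalue (n - j + 1) G - graph_eigenvalue (n - j + 1) (graph_complement G)"

definition neg_max :: "nat \<Rightarrow> nat \<Rightarrow> real" where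
  "neg_max j n = Max (neg_sum j n ` graphs_of_order n)"

lemma neg_max_ge: "G \<in> graphs_of_order n \<Longrightarrow> neg_sum j n G \<le> neg_max j n"
  unfolding neg_max_def by (rule Max_ge) (use finite_graphs_of_order in auto)

lemma neg_max_attained:
  obtains G where "G \<in> graphs_of_order n" "neg_max j n = neg_sum j n G"
proof -
  have "neg_max j n \<in> neg_sum j n ` graphs_of_order n"
    unfolding neg_max_def by (rule Max_in) (use finite_graphs_of_order graphs_of_order_nonempty in auto)
  then show thesis using that by blast
qed

lemma f_neg_n_neg_max:
  assumes j: "0 < j" "j \<le> n"
  shows "neg_max j n \<le> f_neg_n j n" "f_neg_n j n \<le> neg_max j n + 4 * (real n / sqrt (real (n - j + 1)))"
proof -
  let ?f = "\<lambda>G. \<bar>graph_eigenvalue (n - j + 1) G\<bar> + \<bar>graph_eigenvalue (n - j + 1) (graph_complement G)\<bar>"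
  obtain G where G: "G \<in> graphs_of_order n" "neg_max j n = neg_sum j n G" by (rule neg_max_attained)
  have "neg_sum j n G \<le> ?f G" by (simp add: neg_sum_def)
  also have "\<dots> \<le> f_neg_n j n"
    unfolding f_neg_n_def by (rule Max_ge) (use G finite_graphs_of_order in auto)
  finally show "neg_max j n \<le> f_neg_n j n" using G by simp
  have "f_neg_n j n \<in> ?f ` graphs_of_order n"
    unfolding f_neg_n_def by (rule Max_in) (use finite_graphs_of_order graphs_of_order_nonempty in auto)
  then obtain H where H: "H \<in> graphs_of_order n" "f_neg_n j n = ?f H" by blast
  have *: "graph_eigenvalue (n - j + 1) K \<le> real n / sqrt (real (n - j + 1))" if "K \<in> graphs_of_order n" for K
    by (rule graph_eigenvalue_le_sqrt[OF that]) (use j in auto)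
  have "0 \<le> real n / sqrt (real (n - j + 1))" by simp
  with *[OF H(1)] *[OF graph_complement_in_graphs_of_order[OF H(1)]] neg_max_ge[OF H(1), of j]
  show "f_neg_n j n \<le> neg_max j n + 4 * (real n / sqrt (real (n - j + 1)))"
    unfolding H(2) neg_sum_def by linarith
qed

lemma f_neg_properties:
  assumes j: "j > 0"
  shows "f_neg j \<le> 1 / sqrt (2 * real j)"
    and "2 * j \<le> n \<Longrightarrow> (neg_max j n - 1) / real n \<le> f_neg j"
proof -
  let ?C = "1 / sqrt (2 * real j)"
  have bound: "neg_max j n \<le> ?C * real n + 1" if "2 * j \<le> n" for n
  proof -
    obtain G where G: "G \<in> graphs_of_order n" "neg_max j n = neg_sum j n G" by (rule neg_max_attained)
    show ?thesis using graph_eigenvalue_sum_bounds(2)[OF G(1) j that] G(2) by (simp add: neg_sum_def)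
  qed
  have super: "real (m div n) * (neg_max j n - 1) \<le> neg_max j m" if "2 * j \<le> n" "n \<le> m" for n m
  proof -
    obtain G where G: "G \<in> graphs_of_order n" "neg_max j n = neg_sum j n G" by (rule neg_max_attained)
    have "1 \<le> j" "j \<le> n" using that j by auto
    from graph_eigenvalue_blowup(3,4)[OF G(1) that(2) this]
      neg_max_ge[OF graph_blowup_in_graphs_of_order[OF G(1), of m], of j]
    show ?thesis by (simp add: G(2) neg_sum_def algebra_simps)
  qed
  obtain L where L: "(\<lambda>n. neg_max j n / real n) \<longlonglongrightarrow> L"
    "\<And>n. 2 * j \<le> n \<Longrightarrow> (neg_max j n - 1) / real n \<le> L"
    by (rule supermultiplicative_limit[where start = "2 * j", OF super bound]) (use j in auto)
  have "(\<lambda>n. f_neg_n j n / real n) \<longlonglongrightarrow> L"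
  proof (rule tendsto_sandwich[OF _ _ L(1)])
    have "filterlim (\<lambda>n. real (n - j + 1)) at_top sequentially"
      by (rule filterlim_compose[OF filterlim_real_sequentially])
        (rule filterlim_at_top_mono[OF filterlim_minus_const_nat_at_top[of j]], simp)
    then have "(\<lambda>n. 1 / sqrt (real (n - j + 1))) \<longlonglongrightarrow> 0"
      by (intro tendsto_divide_0[OF tendsto_const] filterlim_at_top_imp_at_infinity filterlim_compose[OF sqrt_at_top])
    from tendsto_add[OF L(1) tendsto_mult[OF tendsto_const[of 4] this]]
    show "(\<lambda>n. neg_max j n / real n + 4 * (1 / sqrt (real (n - j + 1)))) \<longlonglongrightarrow> L" by simp
    have ev: "\<forall>\<^sub>F n in sequentially. j \<le> n" by (rule eventually_ge_at_top)
    from ev show "\<forall>\<^sub>F n in sequentially. neg_max j n / real n \<le> f_neg_n j n / real n"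
      by eventually_elim (use f_neg_n_neg_max(1)[OF j] in \<open>auto intro: divide_right_mono\<close>)
    from ev show "\<forall>\<^sub>F n in sequentially. f_neg_n j n / real n \<le> neg_max j n / real n + 4 * (1 / sqrt (real (n - j + 1)))"
    proof eventually_elim
      case (elim n)
      then have "real n > 0" using j by simp
      then have "(neg_max j n + 4 * (real n / sqrt (real (n - j + 1)))) / real n
          = neg_max j n / real n + 4 * (1 / sqrt (real (n - j + 1)))"
        by (simp add: add_divide_distrib)
      then show ?case
        using divide_right_mono[OF f_neg_n_neg_max(2)[OF j elim], of "real n"] by simp
    qed
  qed
  then have f: "f_neg j = L" unfolding f_neg_def by (rule limI)
  then show "2 * j \<le> n \<Longrightarrow> (neg_max j n - 1) / real n \<le> f_neg j" using L(2) by simp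
  have "(\<lambda>n. ?C + 1 / real n) \<longlonglongrightarrow> ?C + 0" by (intro tendsto_intros lim_1_over_n)
  moreover have "\<forall>\<^sub>F n in sequentially. neg_max j n / real n \<le> ?C + 1 / real n"
    using eventually_ge_at_top[of "2 * j"]
  proof eventually_elim
    case (elim n)
    then have "real n > 0" using j by simp
    then have "?C + 1 / real n = (?C * real n + 1) / real n" by (simp add: add_divide_distrib)
    then show ?case using divide_right_mono[OF bound[OF elim], of "real n"] by simp
  qed
  ultimately show "f_neg j \<le> 1 / sqrt (2 * real j)"
    unfolding f using L(1) by (intro tendsto_le[of sequentially]) auto
qed

section \<open>Lower bounds\<close>

lemma sign_graph_estimates:
  fixes q s :: nat
  assumes q: "0 < q" "q \<le> s" and k: "k \<le> q\<^sup>2"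
  defines "n \<equiv> 2 * q * 2 ^ s"
  shows "Suc k \<le> n"
    and "1 / (sqrt 2 * real q) * real n - 2 \<le> f_pos_n (Suc k) n"
    and "0 < k \<Longrightarrow> 1 / (sqrt 2 * real q) * real n \<le> neg_max k n"
proof -
  obtain h :: "nat \<Rightarrow> nat \<Rightarrow> real" where h: "\<forall>c x. h c x = 1 \<or> h c x = -1"
    "\<forall>c<s. (\<Sum>x<2 ^ s. h c x) = 0" "\<forall>c<s. \<forall>d<s. c \<noteq> d \<longrightarrow> (\<Sum>x<2 ^ s. h c x * h d x) = 0"
    using ex_orthogonal_signs[of s] by blast
  interpret latin_sign_matrix q "2 ^ s" h
    by unfold_locales (use h q in auto)
  have n: "vertices = n" by (simp add: vertices_def n_def)
  have "q < 2 ^ s" using q(2) less_exp[of s] by (rule le_less_trans)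
  then have "q * q < q * 2 ^ s" using q by simp
  moreover have "k \<le> q * q" using k by (simp add: power2_eq_square)
  moreover have "n = q * 2 ^ s + q * 2 ^ s" by (simp add: n_def)
  ultimately show kn: "Suc k \<le> n" by linarith
  have \<theta>: "sqrt 2 * real (2 ^ s) = 1 / (sqrt 2 * real q) * real n"
    using q by (simp add: n_def field_simps)
  note G = sign_graph_in_graphs_of_order[unfolded n]
  have "sqrt 2 * real (2 ^ s) / 2 - 1 \<le> graph_eigenvalue (Suc k) sign_graph"
    "sqrt 2 * real (2 ^ s) / 2 - 1 \<le> graph_eigenvalue (Suc k) (graph_complement sign_graph)"
    using kn by (intro graph_eigenvalue_sign_graph(1) k; simp add: n)+
  with f_pos_n_ge[OF G, of "Suc k"]
  show "1 / (sqrt 2 * real q) * real n - 2 \<le> f_pos_n (Suc k) n" unfolding \<theta>[symmetric] by linarith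
  assume "0 < k"
  have "graph_eigenvalue (vertices - k + 1) sign_graph \<le> - (sqrt 2 * real (2 ^ s) / 2)"
    "graph_eigenvalue (vertices - k + 1) (graph_complement sign_graph) \<le> - (sqrt 2 * real (2 ^ s) / 2)"
    using kn \<open>0 < k\<close> by (intro graph_eigenvalue_sign_graph(2) k; simp add: n)+
  with neg_max_ge[OF G, of k]
  show "1 / (sqrt 2 * real q) * real n \<le> neg_max k n" unfolding \<theta>[symmetric] neg_sum_def n by linarith
qed

text \<open>
  The number of binary digits \<open>s\<close>, and with it the order of the sign graph, tends to infinity for
  fixed \<open>q\<close>; this removes the bounded errors.
\<close>

lemma f_pos_f_neg_ge_of_square:
  assumes q: "0 < q" and k: "0 < k" "k \<le> q\<^sup>2"
  shows "1 / (sqrt 2 * real q) \<le> f_pos (Suc k)" "1 / (sqrt 2 * real q) \<le> f_neg k"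
proof -
  define n where "n s = 2 * q * 2 ^ s" for s :: nat
  have n_ge: "s \<le> n s" for s
  proof -
    have "s \<le> 2 ^ s" by (simp add: less_imp_le less_exp)
    also have "\<dots> \<le> 2 * q * 2 ^ s" using q by simp
    finally show ?thesis by (simp add: n_def)
  qed
  then have n_lim: "filterlim n at_top sequentially"
    by (intro filterlim_at_top_mono[OF filterlim_ident]) auto
  have lim: "(\<lambda>s. 1 / (sqrt 2 * real q) - c * (1 / real (n s))) \<longlonglongrightarrow> 1 / (sqrt 2 * real q) - c * 0" for c
    by (intro tendsto_intros filterlim_compose[OF lim_1_over_n n_lim])
  have ev: "\<forall>\<^sub>F s in sequentially. max q (2 * Suc k) \<le> s" by (rule eventually_ge_at_top)
  have "\<forall>\<^sub>F s in sequentially. 1 / (sqrt 2 * real q) - 2 * (1 / real (n s)) \<le> f_pos (Suc k)"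
    using ev
  proof eventually_elim
    case (elim s)
    then have qs: "q \<le> s" "2 * Suc k \<le> n s" using n_ge[of s] by auto
    have "real (n s) > 0" using qs by simp
    then have "1 / (sqrt 2 * real q) - 2 * (1 / real (n s)) = (1 / (sqrt 2 * real q) * real (n s) - 2) / real (n s)"
      by (simp add: diff_divide_distrib)
    also have "\<dots> \<le> f_pos_n (Suc k) (n s) / real (n s)"
      using sign_graph_estimates(2)[OF q qs(1) k(2)] by (intro divide_right_mono) (auto simp: n_def)
    also have "\<dots> \<le> f_pos (Suc k)" using f_pos_properties(2)[of "Suc k" "n s"] qs(2) k(1) by simp
    finally show ?case .
  qed
  then show "1 / (sqrt 2 * real q) \<le> f_pos (Suc k)" using tendsto_upperbound[OF lim[of 2]] by simp
  have "\<forall>\<^sub>F s in sequentially. 1 / (sqrt 2 * real q) - 1 * (1 / real (n s)) \<le> f_neg k"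
    using ev
  proof eventually_elim
    case (elim s)
    then have qs: "q \<le> s" "2 * k \<le> n s" using n_ge[of s] by auto
    have "real (n s) > 0" using qs k by simp
    then have "1 / (sqrt 2 * real q) - 1 * (1 / real (n s)) = (1 / (sqrt 2 * real q) * real (n s) - 1) / real (n s)"
      by (simp add: diff_divide_distrib)
    also have "\<dots> \<le> (neg_max k (n s) - 1) / real (n s)"
      using sign_graph_estimates(3)[OF q qs(1) k(2,1)] by (intro divide_right_mono) (auto simp: n_def)
    also have "\<dots> \<le> f_neg k" by (rule f_neg_properties(2)[OF k(1) qs(2)])
    finally show ?case .
  qed
  then show "1 / (sqrt 2 * real q) \<le> f_neg k" using tendsto_upperbound[OF lim[of 1]] by simp
qed

lemma ex_square_root_ceiling:
  assumes "k > 0"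
  obtains q where "0 < q" "k \<le> q\<^sup>2" "1 / (sqrt (2 * real k) + sqrt 2) < 1 / (sqrt 2 * real q)"
proof -
  define q where "q = nat \<lceil>sqrt (real k)\<rceil>"
  have s: "sqrt (real k) > 0" using assms by simp
  have q: "sqrt (real k) \<le> real q" "real q < sqrt (real k) + 1"
    using s unfolding q_def by linarith+
  have "sqrt (2 * real k) + sqrt 2 = sqrt 2 * (sqrt (real k) + 1)"
    by (simp add: real_sqrt_mult algebra_simps)
  moreover have "sqrt 2 * real q < sqrt 2 * (sqrt (real k) + 1)" using q by simp
  moreover have q0: "0 < real q" using s q by linarith
  ultimately have "1 / (sqrt (2 * real k) + sqrt 2) < 1 / (sqrt 2 * real q)"
    by (intro divide_strict_left_mono) auto
  moreover have "real k \<le> (real q)\<^sup>2" using q s by (metis real_le_lsqrt real_sqrt_le_iff real_sqrt_le_mono real_sqrt_pow2 of_nat_0_le_iff power_mono less_imp_le)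
  then have "k \<le> q\<^sup>2" by (metis of_nat_le_iff of_nat_power)
  ultimately show thesis using that q0 by auto
qed

section \<open>The theorem\<close>

text \<open>
  With \<open>s = sqrt (2 (k - 1))\<close> the difference is \<open>- sqrt 2 / (s (s + sqrt 2))\<close>, and \<open>s\<^sup>2 \<ge> k\<close> for
  \<open>k \<ge> 2\<close>.
\<close>

lemma error_term:
  "(\<lambda>k::nat. 1 / (sqrt (2 * (real k - 1)) + sqrt 2) - 1 / sqrt (2 * (real k - 1)))
        \<in> O[at_top](\<lambda>k. 1 / real k)"
proof (rule bigoI[where c = "sqrt 2"])
  show "\<forall>\<^sub>F k in sequentially. norm (1 / (sqrt (2 * (real k - 1)) + sqrt 2) - 1 / sqrt (2 * (real k - 1)))
      \<le> sqrt 2 * norm (1 / real k)"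
    using eventually_ge_at_top[of 2]
  proof eventually_elim
    case (elim k)
    define s where "s = sqrt (2 * (real k - 1))"
    have s: "s > 0" "s * s = 2 * (real k - 1)" using elim by (auto simp: s_def)
    have "s + sqrt 2 \<noteq> 0" "s \<noteq> 0" using s by (auto simp: add_pos_pos less_imp_neq[symmetric])
    then have "1 / (s + sqrt 2) - 1 / s = - (sqrt 2 / (s * (s + sqrt 2)))"
      by (simp add: diff_frac_eq mult.commute)
    then have "norm (1 / (s + sqrt 2) - 1 / s) = sqrt 2 / (s * (s + sqrt 2))"
      using s by simp
    also have "\<dots> \<le> sqrt 2 / real k"
    proof (rule divide_left_mono)
      have "real k \<le> s * s" using s(2) elim by simp
      also have "\<dots> \<le> s * (s + sqrt 2)" using s(1) by (intro mult_left_mono) auto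
      finally show "real k \<le> s * (s + sqrt 2)" .
    qed (use s elim in \<open>auto intro!: mult_pos_pos add_pos_pos\<close>)
    finally show ?case by (simp add: s_def)
  qed
qed

theorem theorem3p3:
  shows
    "(\<forall>k::nat. k \<ge> 2 \<longrightarrow>
        1 / sqrt (2 * (real k - 1)) \<ge> f_pos k \<and>
        f_pos k > 1 / (sqrt (2 * (real k - 1)) + sqrt 2)) \<and>
     (\<forall>k::nat. k \<ge> 2 \<longrightarrow>
        1 / sqrt (2 * (real k - 1)) \<ge> f_neg (k - 1) \<and>
        f_neg (k - 1) > 1 / (sqrt (2 * (real k - 1)) + sqrt 2)) \<and>
     (\<lambda>k::nat. 1 / (sqrt (2 * (real k - 1)) + sqrt 2) - 1 / sqrt (2 * (real k - 1)))
        \<in> O[at_top](\<lambda>k. 1 / real k)"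
proof (intro conjI allI impI error_term)
  fix k :: nat assume "2 \<le> k"
  then obtain j where j: "0 < j" "k = Suc j" "real k - 1 = real j"
    by (cases k) auto
  obtain q where q: "0 < q" "j \<le> q\<^sup>2" "1 / (sqrt (2 * real j) + sqrt 2) < 1 / (sqrt 2 * real q)"
    by (rule ex_square_root_ceiling[OF j(1)])
  note * = f_pos_f_neg_ge_of_square[OF q(1) j(1) q(2)]
  show "f_pos k \<le> 1 / sqrt (2 * (real k - 1))" by (rule f_pos_properties(1)) fact
  show "1 / (sqrt (2 * (real k - 1)) + sqrt 2) < f_pos k" using q(3) *(1) unfolding j(3) by (simp add: j(2))
  show "f_neg (k - 1) \<le> 1 / sqrt (2 * (real k - 1))"
    using f_neg_properties(1)[OF j(1)] unfolding j(3) by (simp add: j(2))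
  show "1 / (sqrt (2 * (real k - 1)) + sqrt 2) < f_neg (k - 1)" using q(3) *(2) unfolding j(3) by (simp add: j(2))
qed

end
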